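(* Let $f$ be a transcendental entire function such that $\rho_1(f)<+\infty$, let $a$ and $b$ be non-zero complex numbers, and let $n$ be a positive integer. If $f^n$ and $f^{(2)}$ share $a$ CM, and $(f^{(1)})^n$ and $f^{(1)}$ share $b$ CM, then $n=1$.
   Context: $f^{(i)}$ denotes the $i$-th derivative of $f$, and $f^n$, $(f^{(1)})^n$ denote $n$-th powers. Two entire functions $g,h$ share a value $c\in\mathbb{C}$ CM (counting multiplicities) if $g-c$ and $h-c$ have the same zeros with the same multiplicities. $\rho_1(f)=\limsup_{r\to\infty}\frac{\log\log T(r,f)}{\log r}$ is the hyper-order of $f$, where $T(r,f)$ is the Nevanlinna characteristic function. *)

theory Defs
  imports "HOL-Complex_Analysis.Complex_Analysis" "HOL-Library.Extended_Real"
begin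

definition transcendental_entire :: "(complex \<Rightarrow> complex) \<Rightarrow> bool" where
  "transcendental_entire f \<longleftrightarrow>
     f holomorphic_on UNIV \<and> \<not> (\<exists>p. \<forall>z. f z = poly p z)"

text \<open>
  The multiplicity of a zero is its \<open>zorder\<close>. If \<open>g\<close> is identically \<open>c\<close>, the value of
  \<open>zorder\<close> is unspecified, but then the first conjunct already forces \<open>h = g\<close>, so the second
  conjunct holds trivially.
\<close>

definition share_CM :: "(complex \<Rightarrow> complex) \<Rightarrow> (complex \<Rightarrow> complex) \<Rightarrow> complex \<Rightarrow> bool" where
  "share_CM g h c \<longleftrightarrow>
     (\<forall>z. g z - c = 0 \<longleftrightarrow> h z - c = 0) \<and>
     (\<forall>z. g z - c = 0 \<longrightarrow> zorder (\<lambda>w. g w - c) z = zorder (\<lambda>w. h w - c) z)"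

definition log_plus :: "real \<Rightarrow> real" where
  "log_plus x = (if x \<le> 1 then 0 else ln x)"

definition proximity_fun :: "real \<Rightarrow> (complex \<Rightarrow> complex) \<Rightarrow> real" where
  "proximity_fun r f =
     1 / (2 * pi) * integral {0..2 * pi} (\<lambda>\<theta>. log_plus (norm (f (of_real r * cis \<theta>))))"

text \<open>Poles are counted with multiplicity; a pole has negative \<open>zorder\<close>.\<close>

definition pole_count :: "real \<Rightarrow> (complex \<Rightarrow> complex) \<Rightarrow> real" where
  "pole_count t f = (\<Sum>z \<in> {z \<in> cball 0 t. is_pole f z}. of_int (- zorder f z))"

definition counting_fun :: "real \<Rightarrow> (complex \<Rightarrow> complex) \<Rightarrow> real" where
  "counting_fun r f =
     integral {0..r} (\<lambda>t. (pole_count t f - pole_count 0 f) / t) + pole_count 0 f * ln r"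

definition nevanlinna_T :: "real \<Rightarrow> (complex \<Rightarrow> complex) \<Rightarrow> real" where
  "nevanlinna_T r f = proximity_fun r f + counting_fun r f"

text \<open>
  For a transcendental entire \<open>f\<close> the characteristic tends to infinity, so the conventions for
  \<open>ln\<close> at nonpositive arguments do not affect the limit superior.
\<close>

definition hyper_order :: "(complex \<Rightarrow> complex) \<Rightarrow> ereal" where
  "hyper_order f = Limsup at_top (\<lambda>r. ereal (ln (ln (nevanlinna_T r f)) / ln r))"

end

theory Submission
  imports Defs "HOL-Computational_Algebra.Fundamental_Theorem_Algebra"
begin

text \<open>
  Suppose \<open>n \<ge> 2\<close>. Since the \<open>n\<close>-th power of \<open>f'\<close> and \<open>f'\<close> share \<open>b\<close>, the roots of \<open>w\<^sup>n = b\<close> other than \<open>b\<close> are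
  omitted by \<open>f'\<close>. Picard's theorem leaves only \<open>n = 2\<close>, \<open>b = 1\<close> with \<open>-1\<close> omitted
  (\<open>shared_power_omits_minus_one\<close>), so \<open>f' = u - 1\<close> with \<open>u = e\<^sup>\<alpha>\<close> for an entire \<open>\<alpha>\<close>. Sharing \<open>a\<close> with
  multiplicities gives an entire \<open>\<beta>\<close> with \<open>f\<^sup>2 - a = e\<^sup>\<beta> (f'' - a)\<close>.

  The finite hyper-order makes \<open>\<alpha>\<close> and \<open>\<beta>\<close> functions of finite order. The contradiction then
  comes from one principle, \<open>vanishing_where_exp_is_one\<close>: a function \<open>E\<close> of finite order that vanishes
  wherever \<open>e\<^sup>\<beta> = 1\<close> for some non-constant \<open>\<beta>\<close> vanishes identically (provided that \<open>E\<close> is a polynomial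
  whenever \<open>\<beta>\<close> is one). Indeed \<open>E\<close> has at most polynomially many zeros in a disc, whereas by Schottky's
  theorem \<open>\<beta>\<close> attains a number of values \<open>2\<pi>ik\<close> at least proportional to its
  maximum modulus on a smaller disc.

  Differentiating \<open>f\<^sup>2 - a = e\<^sup>\<beta> (f'' - a)\<close>, the left side becomes \<open>2f(u - 1)\<close>, and it vanishes where \<open>u = 1\<close>.
  There the right side is \<open>e\<^sup>\<beta> (\<beta>'(\<alpha>' - a) + \<alpha>'' + \<alpha>'\<^sup>2)\<close>, so the principle makes the expression in parentheses vanish
  identically, and what remains is \<open>2f = a \<beta>' e\<^sup>\<beta>\<close>. Substituting this into the original
  equation and using the principle again, now for \<open>e\<^sup>\<beta> = 1\<close>, gives \<open>e\<^sup>\<beta> = 1\<close> identically and so \<open>f = 0\<close>.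

  The growth statements rest on \<open>zero_free_majorant\<close>, which removes the zeros of a function in a
  disc without changing its modulus on the boundary. Together with the Poisson formula it bounds
  \<open>ln |f|\<close> by the characteristic function (\<open>norm_le_exp_proximity\<close>), and together with the
  Borel--Caratheodory inequality it bounds the exponent in \<open>F = e\<^sup>\<beta> G\<close> (\<open>exponent_growth\<close>).
\<close>

section \<open>Division of holomorphic functions with matching zeros\<close>

text \<open>
  Near each point both functions are a non-vanishing factor times a power of the same linear
  function, so the order condition makes the singularities of the quotient removable; equal orders
  leave a non-zero limit.
\<close>
lemma holomorphic_divide_by_zorder:
  assumes A: "open A" "connected A"
    and F: "F holomorphic_on A" "\<exists>w\<in>A. F w \<noteq> 0"
    and G: "G holomorphic_on A" "\<exists>w\<in>A. G w \<noteq> 0"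
    and ord: "\<And>z. z \<in> A \<Longrightarrow> zorder G z \<le> zorder F z"
  obtains q where "q holomorphic_on A" "\<And>z. z \<in> A \<Longrightarrow> F z = q z * G z"
    "\<And>z. z \<in> A \<Longrightarrow> zorder G z = zorder F z \<Longrightarrow> q z \<noteq> 0"
proof -
  define q where "q = remove_sings (\<lambda>w. F w / G w)"
  have "q field_differentiable at z \<and> F z = q z * G z \<and> (zorder G z = zorder F z \<longrightarrow> q z \<noteq> 0)"
    if z: "z \<in> A" for z
  proof -
    define n where "n = nat (zorder F z)"
    define m where "m = nat (zorder G z)"
    obtain r f1 where r: "r > 0" "cball z r \<subseteq> A" "f1 holomorphic_on cball z r"
      and f1: "\<And>w. w \<in> cball z r \<Longrightarrow> F w = f1 w * (w - z) ^ n \<and> f1 w \<noteq> 0"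
      using zorder_exist_zero[OF F(1) A z F(2)] unfolding n_def by blast
    obtain s g1 where s: "s > 0" "cball z s \<subseteq> A" "g1 holomorphic_on cball z s"
      and g1: "\<And>w. w \<in> cball z s \<Longrightarrow> G w = g1 w * (w - z) ^ m \<and> g1 w \<noteq> 0"
      using zorder_exist_zero[OF G(1) A z G(2)] unfolding m_def by blast
    have mn: "m \<le> n" using ord[OF z] by (simp add: m_def n_def)
    define t where "t = min r s"
    have t: "t > 0" "ball z t \<subseteq> cball z r" "ball z t \<subseteq> cball z s"
      using r s by (auto simp: t_def)
    define \<phi> where "\<phi> = (\<lambda>w. f1 w / g1 w * (w - z) ^ (n - m))"
    have hol: "\<phi> holomorphic_on ball z t"
      unfolding \<phi>_def using t g1
      by (auto intro!: holomorphic_intros intro: holomorphic_on_subset[OF r(3)] holomorphic_on_subset[OF s(3)])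
    have eq: "F w / G w = \<phi> w" if "w \<in> ball z t" "w \<noteq> z" for w
    proof -
      have "(w - z) ^ n = (w - z) ^ (n - m) * (w - z) ^ m"
        using mn by (simp flip: power_add)
      moreover have "F w = f1 w * (w - z) ^ n" "G w = g1 w * (w - z) ^ m"
        using f1[of w] g1[of w] t that by auto
      ultimately show ?thesis using that by (simp add: \<phi>_def)
    qed
    have q: "q w = \<phi> w" if w: "w \<in> ball z t" for w
      unfolding q_def
    proof (rule remove_sings_eqI)
      have "\<phi> \<midarrow>w\<rightarrow> \<phi> w"
        using hol w by (metis at_within_open continuous_on holomorphic_on_imp_continuous_on open_ball)
      moreover have "eventually (\<lambda>x. F x / G x = \<phi> x) (at w)"
      proof -
        have "eventually (\<lambda>x. x \<in> ball z t) (at w)"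
          using w by (intro eventually_at_in_open') auto
        moreover have "eventually (\<lambda>x. x \<noteq> z) (at w)"
          by (rule eventually_neq_at_within)
        ultimately show ?thesis by eventually_elim (use eq in auto)
      qed
      ultimately show "(\<lambda>w. F w / G w) \<midarrow>w\<rightarrow> \<phi> w"
        using tendsto_cong by fastforce
    qed
    have "q holomorphic_on ball z t"
      using hol q by (subst holomorphic_cong[OF refl, of _ q \<phi>]) auto
    then have "q field_differentiable at z"
      using t(1) by (simp add: holomorphic_on_imp_differentiable_at)
    moreover have "F z = q z * G z"
      using q[of z] f1[of z] g1[of z] r(1) s(1) t(1) mn by (auto simp: \<phi>_def power_0_left)
    moreover have "q z \<noteq> 0" if "zorder G z = zorder F z"
      using q[of z] f1[of z] g1[of z] r(1) s(1) t(1) that by (auto simp: \<phi>_def power_0_left m_def n_def)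
    ultimately show ?thesis by blast
  qed
  then show ?thesis
    by (intro that[of q]) (auto simp: holomorphic_on_def field_differentiable_at_within)
qed

lemma zorder_linear_power: "zorder (\<lambda>z. (z - a) ^ m) a = int m"
  by (rule zorder_eqI[of UNIV _ "\<lambda>_. 1"]) auto

lemma zorder_holomorphic:
  assumes "open A" "connected A" "f holomorphic_on A" "\<exists>w\<in>A. f w \<noteq> 0" "z \<in> A"
  shows "if f z = 0 then zorder f z > 0 else zorder f z = 0"
  using zorder_exist_zero[OF assms(3,1,2,5,4)] by blast

lemma zorder_linear_power_other: "z \<noteq> a \<Longrightarrow> zorder (\<lambda>z. (z - a) ^ m) z = 0"
  by (rule zorder_eqI[of UNIV _ "\<lambda>z. (z - a) ^ m"]) (auto intro!: holomorphic_intros)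

lemma holomorphic_factor_linear_power:
  assumes A: "open A" "connected A" and f: "f holomorphic_on A" "\<exists>w\<in>A. f w \<noteq> 0"
    and a: "a \<in> A" and m: "int m \<le> zorder f a"
  obtains g where "g holomorphic_on A" "\<And>z. z \<in> A \<Longrightarrow> f z = g z * (z - a) ^ m"
    "int m = zorder f a \<Longrightarrow> g a \<noteq> 0"
proof (rule holomorphic_divide_by_zorder[OF A f])
  show "(\<lambda>z. (z - a) ^ m) holomorphic_on A" by (intro holomorphic_intros)
  obtain w where "w \<in> A" "w \<noteq> a"
    using A(1) a by (metis islimpt_def islimpt_punctured not_open_singleton open_contains_ball islimpt_UNIV openE singletonD subsetI subset_singleton_iff empty_iff)
  then show "\<exists>w\<in>A. (w - a) ^ m \<noteq> 0" by (intro bexI[of _ w]) auto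
  show "zorder (\<lambda>z. (z - a) ^ m) z \<le> zorder f z" if "z \<in> A" for z
    using m zorder_holomorphic[OF A f that]
    by (cases "z = a") (auto simp: zorder_linear_power zorder_linear_power_other split: if_splits)
qed (use a that in \<open>auto simp: zorder_linear_power\<close>)

text \<open>
  Dividing by distinct linear factors, regardless of multiplicities, is enough for counting
  zeros without multiplicity.
\<close>
lemma holomorphic_factor_finite_zeros:
  assumes A: "open A" "connected A" and S: "finite S" "S \<subseteq> A"
    and f: "f holomorphic_on A" "\<exists>w\<in>A. f w \<noteq> 0" "\<And>s. s \<in> S \<Longrightarrow> f s = 0"
  shows "\<exists>g. g holomorphic_on A \<and> (\<forall>z\<in>A. f z = g z * (\<Prod>s\<in>S. z - s))"
  using S f
proof (induction S arbitrary: f rule: finite_induct)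
  case empty
  then show ?case by auto
next
  case (insert a S f)
  have "zorder f a > 0"
    using zorder_holomorphic[OF A insert.prems(2,3), of a] insert.prems by auto
  then obtain g where g: "g holomorphic_on A" "\<And>z. z \<in> A \<Longrightarrow> f z = g z * (z - a) ^ 1"
    using holomorphic_factor_linear_power[OF A insert.prems(2,3), of a 1] insert.prems(1)
    by (metis int_one_le_iff_zero_less insertI1 of_nat_1 subsetD)
  have gS: "g s = 0" if "s \<in> S" for s
    using g(2)[of s] insert.prems insert.hyps that by (metis eq_iff_diff_eq_0 insert_iff mult_eq_0_iff power_one_right subsetD)
  have gn: "\<exists>w\<in>A. g w \<noteq> 0" using insert.prems(3) g(2) by force
  obtain h where "h holomorphic_on A" "\<forall>z\<in>A. g z = h z * (\<Prod>s\<in>S. z - s)"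
    using insert.IH[OF _ g(1) gn gS] insert.prems(1) by auto
  then show ?case using g(2) insert.hyps by (intro exI[of _ h]) (auto simp: mult_ac)
qed

section \<open>Removing zeros without changing the modulus on a circle\<close>

text \<open>
  The Blaschke factor \<open>R (z - a) / (R\<^sup>2 - cnj a z)\<close> has modulus at most 1 in the disc of radius \<open>R\<close>
  and modulus 1 on its boundary.
\<close>
lemma blaschke_norm_le:
  fixes z a :: complex
  assumes "norm a < R"
  shows "norm z \<le> R \<Longrightarrow> norm (z - a) \<le> norm ((of_real R ^ 2 - cnj a * z) / of_real R)"
    and "norm z = R \<Longrightarrow> norm (z - a) = norm ((of_real R ^ 2 - cnj a * z) / of_real R)"
proof -
  have R: "R > 0" using assms norm_ge_zero[of a] by linarith
  have id: "norm (of_real R ^ 2 - cnj a * z) ^ 2 - R^2 * norm (z - a) ^ 2 =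
      (R^2 - norm z ^ 2) * (R^2 - norm a ^ 2)"
    unfolding cmod_power2 by (cases z, cases a) (simp add: power2_eq_square algebra_simps)
  have eq: "norm ((of_real R ^ 2 - cnj a * z) / of_real R) = norm (of_real R ^ 2 - cnj a * z) / R"
    using R by (simp add: norm_divide)
  show "norm (z - a) \<le> norm ((of_real R ^ 2 - cnj a * z) / of_real R)" if "norm z \<le> R"
  proof -
    have "norm z ^ 2 \<le> R ^ 2" "norm a ^ 2 \<le> R ^ 2"
      using that assms by (auto intro!: power_mono)
    then have "(R * norm (z - a)) ^ 2 \<le> norm (of_real R ^ 2 - cnj a * z) ^ 2"
      using id by (smt (verit) mult_nonneg_nonneg power_mult_distrib)
    then have "R * norm (z - a) \<le> norm (of_real R ^ 2 - cnj a * z)"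
      by (rule power2_le_imp_le) auto
    then show ?thesis unfolding eq using R by (simp add: field_simps)
  qed
  show "norm (z - a) = norm ((of_real R ^ 2 - cnj a * z) / of_real R)" if "norm z = R"
  proof -
    have "(R * norm (z - a)) ^ 2 = norm (of_real R ^ 2 - cnj a * z) ^ 2"
      using id that by (simp add: power_mult_distrib)
    then have "R * norm (z - a) = norm (of_real R ^ 2 - cnj a * z)"
      using R by (simp add: power2_eq_iff_nonneg)
    then show ?thesis unfolding eq using R by (simp add: field_simps)
  qed
qed

text \<open>
  Replacing every zero in the disc by its Blaschke reflection gives a function without zeros,
  which has a logarithm \<open>h\<close>. Since \<open>Re h\<close> is harmonic, this turns \<open>ln |f|\<close> into something to
  which the Poisson formula and the Borel--Caratheodory inequality apply; it plays the part of
  Jensen's formula.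
\<close>
lemma zero_free_majorant:
  assumes "R > 0" "S > R" and f: "f holomorphic_on ball 0 S"
    and sph: "\<And>z. norm z = R \<Longrightarrow> f z \<noteq> 0"
    and fin: "finite {z \<in> cball 0 R. f z = 0}"
  shows "\<exists>T h. T > R \<and> h holomorphic_on ball 0 T \<and>
    (\<forall>z\<in>cball 0 R. norm (f z) \<le> norm (exp (h z))) \<and>
    (\<forall>z. norm z = R \<longrightarrow> norm (f z) = norm (exp (h z)))"
  using f sph fin
proof (induction "card {z \<in> cball 0 R. f z = 0}" arbitrary: f)
  case 0
  define K where "K = {z \<in> cball 0 ((R + S) / 2). f z = 0}"
  have "cball 0 ((R + S) / 2) \<subseteq> ball (0::complex) S"
    using \<open>S > R\<close> by (auto simp: field_simps)
  then have "continuous_on (cball 0 ((R + S) / 2)) f"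
    using 0(2) holomorphic_on_imp_continuous_on holomorphic_on_subset by blast
  then have "closed K" unfolding K_def
    by (rule continuous_closed_preimage_constant) auto
  moreover have "bounded K" unfolding K_def by (rule bounded_subset[of "cball 0 ((R + S) / 2)"]) auto
  ultimately have "compact K" by (simp add: compact_eq_bounded_closed)
  have "K \<inter> cball 0 R = {}" using 0 \<open>S > R\<close> by (auto simp: K_def)
  obtain T where T: "R < T" "T \<le> (R + S) / 2" "\<And>z. norm z < T \<Longrightarrow> f z \<noteq> 0"
  proof (cases "K = {}")
    case True
    then show ?thesis using \<open>S > R\<close> by (intro that[of "(R + S) / 2"]) (auto simp: K_def)
  next
    case False
    obtain k where k: "k \<in> K" "\<And>z. z \<in> K \<Longrightarrow> norm k \<le> norm z"
      using continuous_attains_inf[OF \<open>compact K\<close> False, of norm] continuous_on_norm_id by blast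
    then have "norm k > R" using \<open>K \<inter> cball 0 R = {}\<close> by fastforce
    moreover have "norm k \<le> (R + S) / 2" using k(1) by (auto simp: K_def)
    moreover have "f z \<noteq> 0" if "norm z < norm k" for z
    proof
      assume "f z = 0"
      then have "z \<in> K" using that \<open>norm k \<le> _\<close> by (simp add: K_def)
      then show False using k(2) that by fastforce
    qed
    ultimately show ?thesis by (intro that[of "norm k"])
  qed
  have "T \<le> S" using T \<open>S > R\<close> by simp
  then have "f holomorphic_on ball 0 T"
    using 0(2) by (meson holomorphic_on_subset subset_ball)
  then obtain h where h: "h holomorphic_on ball 0 T" "\<And>x. x \<in> ball 0 T \<Longrightarrow> exp (h x) = f x"
    using holomorphic_logarithm_exists[of "ball 0 T" f 0] T \<open>R > 0\<close> by auto
  show ?case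
    using T(1) h by (intro exI[of _ T] exI[of _ h]) auto
next
  case (Suc n f)
  then have "{z \<in> cball 0 R. f z = 0} \<noteq> {}" by (metis card.empty nat.distinct(1))
  then obtain a where a: "norm a \<le> R" "f a = 0" by auto
  then have aR: "norm a < R" using Suc.prems(2)[of a] by force
  have A: "open (ball (0::complex) S)" "connected (ball (0::complex) S)" by auto
  have nz: "\<exists>w\<in>ball 0 S. f w \<noteq> 0"
    using \<open>R > 0\<close> \<open>S > R\<close> Suc.prems(2)[of "of_real R"] by (intro bexI[of _ "of_real R"]) auto
  define m where "m = nat (zorder f a)"
  have zo: "zorder f a > 0"
    using zorder_holomorphic[OF A Suc.prems(1) nz, of a] a aR \<open>S > R\<close> by auto
  obtain g where g: "g holomorphic_on ball 0 S" "\<And>z. z \<in> ball 0 S \<Longrightarrow> f z = g z * (z - a) ^ m" "g a \<noteq> 0"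
    using holomorphic_factor_linear_power[OF A Suc.prems(1) nz, of a m] zo aR \<open>S > R\<close>
    by (auto simp: m_def)
  have m: "m > 0" using zo by (simp add: m_def)
  \<comment> \<open>the full power of \<open>z - a\<close> is reflected at once, so the number of distinct zeros drops\<close>
  define f1 where "f1 = (\<lambda>z. g z * ((of_real R ^ 2 - cnj a * z) / of_real R) ^ m)"
  have f1: "f1 holomorphic_on ball 0 S" unfolding f1_def using \<open>R > 0\<close> by (intro holomorphic_intros g) auto
  have bz: "of_real R ^ 2 - cnj a * z \<noteq> 0" if "norm z \<le> R" for z
  proof
    assume "of_real R ^ 2 - cnj a * z = 0"
    then have "of_real R ^ 2 = cnj a * z" by simp
    then have "norm (of_real R ^ 2 :: complex) = norm (cnj a * z)" by simp
    then have "R^2 = norm a * norm z" by (simp add: norm_mult norm_power)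
    also have "\<dots> \<le> norm a * R" using that by (intro mult_left_mono) auto
    also have "\<dots> < R * R" using aR \<open>R > 0\<close> by simp
    finally show False by (simp add: power2_eq_square)
  qed
  have inS: "z \<in> ball 0 S" if "norm z \<le> R" for z :: complex using that \<open>S > R\<close> by simp
  have zeros: "{z \<in> cball 0 R. f1 z = 0} = {z \<in> cball 0 R. f z = 0} - {a}"
    using g(2,3) bz inS m \<open>R > 0\<close> by (auto simp: f1_def)
  have le: "norm (f z) \<le> norm (f1 z)" if "norm z \<le> R" for z
    using blaschke_norm_le(1)[OF aR that] g(2)[OF inS[OF that]]
    by (auto simp: f1_def norm_mult norm_power intro!: mult_left_mono power_mono)
  have eq: "norm (f z) = norm (f1 z)" if "norm z = R" for z
    using blaschke_norm_le(2)[OF aR that] g(2)[OF inS] that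
    by (auto simp: f1_def norm_mult norm_power)
  have "n = card {z \<in> cball 0 R. f1 z = 0}"
    unfolding zeros using Suc.hyps(2) a Suc.prems(3) by auto
  moreover have "finite {z \<in> cball 0 R. f1 z = 0}" unfolding zeros using Suc.prems(3) by blast
  moreover have "f1 z \<noteq> 0" if "norm z = R" for z using eq[OF that] Suc.prems(2)[OF that] by auto
  ultimately obtain T h where "T > R" "h holomorphic_on ball 0 T"
    "\<forall>z\<in>cball 0 R. norm (f1 z) \<le> norm (exp (h z))"
    "\<forall>z. norm z = R \<longrightarrow> norm (f1 z) = norm (exp (h z))"
    using Suc.hyps(1)[OF _ f1] by blast
  then show ?case using le eq
    by (intro exI[of _ T] exI[of _ h]) (auto intro: order_trans[OF le])
qed

lemma entire_finite_zeros:
  assumes "f holomorphic_on UNIV" "\<exists>w. f w \<noteq> (0::complex)"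
  shows "finite {z \<in> cball c R. f z = 0}"
proof (cases "\<exists>k. \<forall>z. f z = k")
  case True
  then show ?thesis using assms(2) by auto
next
  case False
  then show ?thesis
    using holomorphic_compact_finite_zeros[OF assms(1), of "cball c R"]
    by (auto simp: constant_on_def)
qed

text \<open>
  The radius has to avoid the moduli of the zeros, so it is only determined up to a factor 2.
\<close>
lemma entire_zero_free_majorant:
  assumes f: "f holomorphic_on UNIV" "\<exists>w. f w \<noteq> (0::complex)" and R: "R > 0"
  obtains \<rho> T h where "R < \<rho>" "\<rho> < 2 * R" "\<rho> < T" "h holomorphic_on ball 0 T"
    "\<And>z. norm z \<le> \<rho> \<Longrightarrow> norm (f z) \<le> norm (exp (h z))"
    "\<And>z. norm z = \<rho> \<Longrightarrow> norm (f z) = norm (exp (h z))"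
proof -
  have "finite (norm ` {z \<in> cball 0 (2 * R). f z = 0})"
    using entire_finite_zeros[OF f] by blast
  then obtain \<rho> where \<rho>: "\<rho> \<in> {R<..<2*R}" "\<rho> \<notin> norm ` {z \<in> cball 0 (2 * R). f z = 0}"
  proof -
    have "infinite {R<..<2*R}" using R by (intro infinite_Ioo) auto
    then have "\<not> {R<..<2*R} \<subseteq> norm ` {z \<in> cball 0 (2 * R). f z = 0}"
      using \<open>finite _\<close> finite_subset by blast
    then show ?thesis using that by blast
  qed
  then have "f z \<noteq> 0" if "norm z = \<rho>" for z using that by force
  then have "\<exists>T h. T > \<rho> \<and> h holomorphic_on ball 0 T \<and>
    (\<forall>z\<in>cball 0 \<rho>. norm (f z) \<le> norm (exp (h z))) \<and>
    (\<forall>z. norm z = \<rho> \<longrightarrow> norm (f z) = norm (exp (h z)))"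
    using R \<rho> entire_finite_zeros[OF f, of 0 \<rho>]
    by (intro zero_free_majorant[of _ "\<rho> + 1"]) (auto intro: holomorphic_on_subset[OF f(1)])
  then show ?thesis using \<rho> that by auto
qed

section \<open>Bounds for exponents and the Poisson formula\<close>

text \<open>
  Apply the Schwarz lemma to \<open>x / (2 D - x)\<close> with \<open>x = k(R w) - k(0)\<close>: this Moebius map sends
  the half plane \<open>Re x < D\<close> into the unit disc.
\<close>
lemma borel_caratheodory_half_disc:
  assumes k: "k holomorphic_on ball 0 R" and M: "\<And>w. norm w < R \<Longrightarrow> Re (k w) < M"
    and R: "R > 0" and z: "norm z \<le> R / 2"
  shows "norm (k z - k 0) \<le> 2 * (M - Re (k 0))"
proof -
  define D where "D = M - Re (k 0)"
  have D: "D > 0" using M[of 0] R by (simp add: D_def)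
  define x where "x = (\<lambda>w. k (of_real R * w) - k 0)"
  define \<phi> where "\<phi> = (\<lambda>w. x w / (2 * of_real D - x w))"
  have inR: "norm (of_real R * w) < R" if "norm w < 1" for w :: complex
    using that R by (simp add: norm_mult)
  have Re: "Re (x w) < D" if "norm w < 1" for w
    using M[OF inR[OF that]] by (simp add: x_def D_def)
  have lt: "norm (x w) < norm (2 * of_real D - x w)" if "norm w < 1" for w
  proof -
    have "norm (2 * of_real D - x w) ^ 2 - norm (x w) ^ 2 = 4 * D * (D - Re (x w))"
      unfolding cmod_power2 by (simp add: power2_eq_square algebra_simps)
    also have "\<dots> > 0" using Re[OF that] D by simp
    finally show ?thesis by (intro power2_less_imp_less[of "norm (x w)"]) auto
  qed
  have hx: "x holomorphic_on ball 0 1"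
    unfolding x_def
    by (intro holomorphic_intros holomorphic_on_compose_gen[OF _ k, unfolded o_def]) (use inR in auto)
  have "\<phi> holomorphic_on ball 0 1"
    unfolding \<phi>_def by (intro holomorphic_intros hx) (use lt in fastforce)
  moreover have "\<phi> 0 = 0" by (simp add: \<phi>_def x_def)
  moreover have "norm (\<phi> w) < 1" if "norm w < 1" for w
  proof -
    have "norm (2 * of_real D - x w) > 0" using lt[OF that] norm_ge_zero[of "x w"] by linarith
    then show ?thesis using lt[OF that] by (simp add: \<phi>_def norm_divide)
  qed
  moreover define w where "w = z / of_real R"
  have w: "norm w \<le> 1 / 2" using z R by (simp add: w_def norm_divide field_simps)
  ultimately have "norm (\<phi> w) \<le> 1 / 2" using Schwarz_Lemma(1)[of \<phi> w] by simp
  moreover have "norm (2 * of_real D - x w) > 0"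
    using lt[of w] w norm_ge_zero[of "x w"] by linarith
  ultimately have "2 * norm (x w) \<le> norm (2 * of_real D - x w)"
    by (simp add: \<phi>_def norm_divide field_simps)
  also have "\<dots> \<le> norm (2 * of_real D :: complex) + norm (x w)" by (rule norm_triangle_ineq4)
  finally have "norm (x w) \<le> 2 * D" using D by (simp add: norm_mult)
  then show ?thesis using R by (simp add: x_def w_def D_def)
qed

lemma Re_le_of_sphere:
  fixes k :: "complex \<Rightarrow> complex"
  assumes k: "k holomorphic_on ball 0 T" and "\<rho> < T"
    and "\<And>z. norm z = \<rho> \<Longrightarrow> Re (k z) \<le> m" and "norm z \<le> \<rho>" "\<rho> > 0"
  shows "Re (k z) \<le> m"
proof (rule maximum_real_frontier[of k "cball 0 \<rho>"])
  have "cball 0 \<rho> \<subseteq> ball (0::complex) T" using assms by auto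
  then show "continuous_on (closure (cball 0 \<rho>)) k"
    using k by (metis closed_cball closure_closed holomorphic_on_imp_continuous_on holomorphic_on_subset)
  show "k holomorphic_on interior (cball 0 \<rho>)"
    using k \<open>cball 0 \<rho> \<subseteq> ball 0 T\<close> holomorphic_on_subset interior_subset by blast
  show "Re (k z) \<le> m" if "z \<in> frontier (cball 0 \<rho>)" for z
    using that assms by (simp add: frontier_cball)
qed (use assms in auto)

text \<open>
  Write \<open>|G| = |e\<^sup>h|\<close> on a circle as in the previous part. Then \<open>h\<close> and \<open>\<beta> + h\<close> both have real
  part at most \<open>m\<close> on the circle, because there \<open>|e\<^sup>h| = |G|\<close> and \<open>|exp (\<beta> + h)| = |F|\<close>. Hence both are
  controlled on a smaller disc by Borel--Caratheodory, and so is their difference \<open>\<beta>\<close>.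
\<close>
lemma exponent_bound_centre:
  assumes F: "F holomorphic_on UNIV" and G: "G holomorphic_on UNIV" "G 0 \<noteq> 0"
    and b: "\<beta> holomorphic_on UNIV" and FG: "\<And>z. F z = exp (\<beta> z) * G z"
  obtains C where "\<And>R m z. R > 0 \<Longrightarrow> (\<And>w. norm w \<le> 2 * R \<Longrightarrow> norm (F w) \<le> exp m) \<Longrightarrow>
     (\<And>w. norm w \<le> 2 * R \<Longrightarrow> norm (G w) \<le> exp m) \<Longrightarrow> norm z \<le> R / 2 \<Longrightarrow>
     norm (\<beta> z) \<le> 4 * m + C"
proof -
  define C where "C = 4 - 4 * ln (norm (G 0)) - 2 * Re (\<beta> 0) + norm (\<beta> 0)"
  have "norm (\<beta> z) \<le> 4 * m + C"
    if R: "R > 0" and Fm: "\<And>w. norm w \<le> 2 * R \<Longrightarrow> norm (F w) \<le> exp m"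
      and Gm: "\<And>w. norm w \<le> 2 * R \<Longrightarrow> norm (G w) \<le> exp m" and z: "norm z \<le> R / 2" for R m z
  proof -
    obtain \<rho> T h where \<rho>: "R < \<rho>" "\<rho> < 2 * R" "\<rho> < T" and h: "h holomorphic_on ball 0 T"
      and le: "\<And>z. norm z \<le> \<rho> \<Longrightarrow> norm (G z) \<le> norm (exp (h z))"
      and eq: "\<And>z. norm z = \<rho> \<Longrightarrow> norm (G z) = norm (exp (h z))"
      using entire_zero_free_majorant[OF G(1) _ R] G(2) by metis
    define k where "k = (\<lambda>z. \<beta> z + h z)"
    have k: "k holomorphic_on ball 0 T" unfolding k_def
      by (intro holomorphic_intros h holomorphic_on_subset[OF b]) auto
    have Gne: "Re (h 0) \<ge> ln (norm (G 0))"
    proof -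
      have "ln (norm (G 0)) \<le> ln (exp (Re (h 0)))"
        using le[of 0] R \<rho> G(2) by (subst ln_le_cancel_iff) auto
      then show ?thesis by simp
    qed
    have "Re (h z) \<le> m" if "norm z = \<rho>" for z
      using eq[OF that] Gm[of z] that \<rho> by (simp add: norm_exp_eq_Re)
    then have h1: "Re (h z) \<le> m" if "norm z \<le> \<rho>" for z
      using Re_le_of_sphere[OF h \<rho>(3), of m z] that R \<rho> by auto
    have "Re (k z) \<le> m" if "norm z = \<rho>" for z
    proof -
      have "exp (Re (k z)) = norm (F z)"
        using eq[OF that] by (simp add: FG k_def norm_mult norm_exp_eq_Re exp_add)
      also have "\<dots> \<le> exp m" using Fm[of z] that \<rho> by auto
      finally show ?thesis by simp
    qed
    then have k1: "Re (k z) \<le> m" if "norm z \<le> \<rho>" for z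
      using Re_le_of_sphere[OF k \<rho>(3), of m z] that R \<rho> by auto
    have sub: "ball 0 R \<subseteq> ball (0::complex) T" using \<rho> by (intro subset_ball) auto
    have "norm (h z - h 0) \<le> 2 * (m + 1 - Re (h 0))"
    proof (rule borel_caratheodory_half_disc[OF holomorphic_on_subset[OF h sub] _ R z])
      show "Re (h w) < m + 1" if "norm w < R" for w using h1[of w] that \<rho> by auto
    qed
    moreover have "norm (k z - k 0) \<le> 2 * (m + 1 - Re (k 0))"
    proof (rule borel_caratheodory_half_disc[OF holomorphic_on_subset[OF k sub] _ R z])
      show "Re (k w) < m + 1" if "norm w < R" for w using k1[of w] that \<rho> by auto
    qed
    moreover have "\<beta> z = (k z - k 0) - (h z - h 0) + \<beta> 0" by (simp add: k_def)
    then have "norm (\<beta> z) = norm ((k z - k 0) - (h z - h 0) + \<beta> 0)" by simp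
    then have "norm (\<beta> z) \<le> norm (k z - k 0) + norm (h z - h 0) + norm (\<beta> 0)"
      using norm_triangle_ineq[of "(k z - k 0) - (h z - h 0)" "\<beta> 0"]
        norm_triangle_ineq4[of "k z - k 0" "h z - h 0"] by linarith
    ultimately show ?thesis using Gne by (simp add: k_def C_def algebra_simps)
  qed
  then show ?thesis using that by blast
qed

text \<open>
  Moving the centre to a point where \<open>G\<close> does not vanish.
\<close>
lemma exponent_bound:
  assumes F: "F holomorphic_on UNIV" and G: "G holomorphic_on UNIV" "\<exists>w. G w \<noteq> 0"
    and b: "\<beta> holomorphic_on UNIV" and FG: "\<And>z. F z = exp (\<beta> z) * G z"
  obtains C d where "d \<ge> 0" "\<And>m z. (\<And>w. norm w \<le> 4 * norm z + d \<Longrightarrow> norm (F w) \<le> exp m) \<Longrightarrow>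
     (\<And>w. norm w \<le> 4 * norm z + d \<Longrightarrow> norm (G w) \<le> exp m) \<Longrightarrow> norm (\<beta> z) \<le> 4 * m + C"
proof -
  obtain c where c: "G c \<noteq> 0" using G(2) by blast
  have sh: "(\<lambda>z. f (c + z)) holomorphic_on UNIV" if "f holomorphic_on UNIV" for f :: "complex \<Rightarrow> complex"
    by (rule holomorphic_on_compose_gen[OF _ that, unfolded o_def]) (auto intro!: holomorphic_intros)
  obtain C where C: "\<And>R m z. R > 0 \<Longrightarrow> (\<And>w. norm w \<le> 2 * R \<Longrightarrow> norm (F (c + w)) \<le> exp m) \<Longrightarrow>
     (\<And>w. norm w \<le> 2 * R \<Longrightarrow> norm (G (c + w)) \<le> exp m) \<Longrightarrow> norm z \<le> R / 2 \<Longrightarrow>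
     norm (\<beta> (c + z)) \<le> 4 * m + C"
    by (rule exponent_bound_centre[OF sh[OF F] sh[OF G(1)] _ sh[OF b]])
       (use c FG in \<open>simp, blast, blast\<close>)
  show ?thesis
  proof (rule that[of "5 * norm c + 2" C])
    fix m :: real and z :: complex
    assume Fm: "\<And>w. norm w \<le> 4 * norm z + (5 * norm c + 2) \<Longrightarrow> norm (F w) \<le> exp m"
    assume Gm: "\<And>w. norm w \<le> 4 * norm z + (5 * norm c + 2) \<Longrightarrow> norm (G w) \<le> exp m"
    have v: "norm (z - c) \<le> norm z + norm c" by (rule norm_triangle_ineq4)
    have *: "norm (c + w) \<le> 4 * norm z + (5 * norm c + 2)" if "norm w \<le> 2 * (2 * norm (z - c) + 1)" for w
    proof -
      have "norm (c + w) \<le> norm c + norm w" by (rule norm_triangle_ineq)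
      also have "norm w \<le> 4 * norm (z - c) + 2" using that by simp
      also have "norm (z - c) \<le> norm z + norm c" by (rule v)
      finally show ?thesis by simp
    qed
    have "norm (\<beta> (c + (z - c))) \<le> 4 * m + C"
    proof (rule C[of "2 * norm (z - c) + 1"])
      show "2 * norm (z - c) + 1 > 0" using norm_ge_zero[of "z - c"] by linarith
      show "norm (F (c + w)) \<le> exp m" if "norm w \<le> 2 * (2 * norm (z - c) + 1)" for w
        using Fm *[OF that] by blast
      show "norm (G (c + w)) \<le> exp m" if "norm w \<le> 2 * (2 * norm (z - c) + 1)" for w
        using Gm *[OF that] by blast
      show "norm (z - c) \<le> (2 * norm (z - c) + 1) / 2" by simp
    qed
    then show "norm (\<beta> z) \<le> 4 * m + C" by simp
  qed auto
qed

text \<open>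
  The function \<open>k(u) (R\<^sup>2 - |z|\<^sup>2) / (R\<^sup>2 - cnj z u)\<close> takes the value \<open>k(z)\<close> at \<open>z\<close>, and on the circle
  its Cauchy kernel is the real Poisson kernel; so a single use of Cauchy's formula suffices.
\<close>
lemma poisson_formula_Re:
  assumes k: "k holomorphic_on cball 0 R" and z: "norm z < R"
  shows "((\<lambda>t. Re (k (of_real R * cis t)) * ((R\<^sup>2 - (norm z)\<^sup>2) / (norm (of_real R * cis t - z))\<^sup>2))
    has_integral (2 * pi * Re (k z))) {0..2 * pi}"
proof -
  have R: "R > 0" using z norm_ge_zero[of z] by linarith
  define f where "f = (\<lambda>u. k u * of_real (R\<^sup>2 - (norm z)\<^sup>2) / (of_real (R\<^sup>2) - cnj z * u))"
  have ne: "of_real (R\<^sup>2) - cnj z * u \<noteq> 0" if "norm u \<le> R" for u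
  proof
    assume "of_real (R\<^sup>2) - cnj z * u = 0"
    then have "of_real (R\<^sup>2) = cnj z * u" by simp
    then have "norm (of_real (R\<^sup>2) :: complex) = norm (cnj z * u)" by simp
    then have "R * R = norm z * norm u" by (simp add: norm_mult norm_power power2_eq_square)
    moreover have "norm z * norm u \<le> norm z * R" using that by (intro mult_left_mono) auto
    moreover have "norm z * R < R * R" using z R by simp
    ultimately show False by linarith
  qed
  have "f holomorphic_on cball 0 R" unfolding f_def
    by (intro holomorphic_intros k) (use ne in auto)
  then have "((\<lambda>u. f u / (u - z)) has_contour_integral (2 * of_real pi * \<i> * f z)) (circlepath 0 R)"
    by (rule Cauchy_integral_circlepath_simple) (use z in auto)
  moreover have "f z = k z"
  proof -
    have "of_real (R\<^sup>2 - (norm z)\<^sup>2) = of_real (R\<^sup>2) - cnj z * z"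
      by (simp add: complex_norm_square[symmetric] mult.commute flip: of_real_power)
    then show ?thesis using ne[of z] z by (simp add: f_def)
  qed
  ultimately have "((\<lambda>t. f (of_real R * cis t) / (of_real R * cis t - z) * R * \<i> * cis t)
      has_integral (2 * of_real pi * \<i> * k z)) {0..2 * pi}"
    unfolding circlepath_def by (subst (asm) has_contour_integral_part_circlepath_iff) auto
  from has_integral_mult_right[OF this, of "1 / \<i>"]
  have "((\<lambda>t. f (of_real R * cis t) / (of_real R * cis t - z) * R * cis t)
      has_integral (2 * of_real pi * k z)) {0..2 * pi}"
    by (simp add: mult_ac)
  moreover have "f \<zeta> / (\<zeta> - z) * \<zeta> = k \<zeta> * of_real ((R\<^sup>2 - (norm z)\<^sup>2) / (norm (\<zeta> - z))\<^sup>2)"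
    if "norm \<zeta> = R" for \<zeta>
  proof -
    have "of_real (R\<^sup>2) = \<zeta> * cnj \<zeta>" using that by (metis complex_norm_square of_real_power)
    then have 1: "of_real (R\<^sup>2) - cnj z * \<zeta> = \<zeta> * cnj (\<zeta> - z)" by (simp add: algebra_simps)
    have 2: "complex_of_real ((norm (\<zeta> - z))\<^sup>2) = (\<zeta> - z) * cnj (\<zeta> - z)"
      using complex_norm_square by auto
    have "\<zeta> \<noteq> 0" "\<zeta> - z \<noteq> 0" "cnj (\<zeta> - z) \<noteq> 0" using that R z by auto
    moreover have "K * P / (\<zeta> * B) / A * \<zeta> = K * (P / (A * B))"
      if "\<zeta> \<noteq> 0" "A \<noteq> 0" "B \<noteq> 0" for K P A B
      using that by simp
    ultimately show ?thesis unfolding f_def 1 of_real_divide 2 by blast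
  qed
  then have "f (of_real R * cis t) / (of_real R * cis t - z) * R * cis t =
      k (of_real R * cis t) * of_real ((R\<^sup>2 - (norm z)\<^sup>2) / (norm (of_real R * cis t - z))\<^sup>2)" for t
    using R by (simp add: norm_mult mult.assoc)
  ultimately have "((\<lambda>t. k (of_real R * cis t) * of_real ((R\<^sup>2 - (norm z)\<^sup>2) / (norm (of_real R * cis t - z))\<^sup>2))
      has_integral (2 * of_real pi * k z)) {0..2 * pi}" by simp
  from has_integral_linear[OF this bounded_linear_Re]
  show ?thesis by (simp add: o_def)
qed

lemma poisson_upper_bound:
  assumes k: "k holomorphic_on cball 0 R" and z: "norm z \<le> R / 2" and "R > 0"
  shows "Re (k z) \<le> 3 * (1 / (2 * pi) * integral {0..2 * pi} (\<lambda>t. max 0 (Re (k (of_real R * cis t)))))"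
proof -
  have "continuous_on {0..2 * pi} (\<lambda>t. k (of_real R * cis t))"
    by (rule continuous_on_compose2[OF holomorphic_on_imp_continuous_on[OF k]])
       (use \<open>R > 0\<close> in \<open>auto intro!: continuous_intros simp: norm_mult\<close>)
  then have "continuous_on {0..2 * pi} (\<lambda>t. max 0 (Re (k (of_real R * cis t))))"
    by (intro continuous_intros)
  then have "(\<lambda>t. max 0 (Re (k (of_real R * cis t)))) integrable_on {0..2 * pi}"
    by (rule integrable_continuous_real)
  then have I: "((\<lambda>t. 3 * max 0 (Re (k (of_real R * cis t)))) has_integral
      (3 * integral {0..2 * pi} (\<lambda>t. max 0 (Re (k (of_real R * cis t)))))) {0..2 * pi}"
    by (intro has_integral_mult_right) auto
  have "2 * pi * Re (k z) \<le> 3 * integral {0..2 * pi} (\<lambda>t. max 0 (Re (k (of_real R * cis t))))"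
  proof (rule has_integral_le[OF poisson_formula_Re[OF k] I])
    show "norm z < R" using z \<open>R > 0\<close> by linarith
    fix t
    define \<zeta> where "\<zeta> = of_real R * cis t"
    have n: "norm \<zeta> = R" using \<open>R > 0\<close> by (simp add: \<zeta>_def norm_mult)
    have lo: "R - norm z \<le> norm (\<zeta> - z)" using norm_triangle_ineq2[of \<zeta> z] n by simp
    have lo0: "0 < R - norm z" using z \<open>R > 0\<close> by linarith
    have "R\<^sup>2 - (norm z)\<^sup>2 = (R + norm z) * (R - norm z)" by (simp add: power2_eq_square algebra_simps)
    also have "\<dots> \<le> (3 * (R - norm z)) * (R - norm z)"
      using z lo0 by (intro mult_right_mono) auto
    also have "\<dots> = 3 * (R - norm z)\<^sup>2" by (simp add: power2_eq_square)
    also have "\<dots> \<le> 3 * (norm (\<zeta> - z))\<^sup>2"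
      using power_mono[OF lo, of 2] lo0 by simp
    finally have "(R\<^sup>2 - (norm z)\<^sup>2) / (norm (\<zeta> - z))\<^sup>2 \<le> 3"
      using lo lo0 by (simp add: divide_le_eq)
    moreover have "(R\<^sup>2 - (norm z)\<^sup>2) / (norm (\<zeta> - z))\<^sup>2 \<ge> 0"
      using z \<open>R > 0\<close> by (intro divide_nonneg_nonneg) (auto intro!: power_mono)
    moreover have "x * p \<le> 3 * max 0 x" if "p \<le> 3" "p \<ge> 0" for x p :: real
    proof -
      have "x * p \<le> max 0 x * p" using that by (intro mult_right_mono) auto
      also have "\<dots> \<le> max 0 x * 3" using that by (intro mult_left_mono) auto
      finally show ?thesis by simp
    qed
    ultimately show "Re (k \<zeta>) * ((R\<^sup>2 - (norm z)\<^sup>2) / (norm (\<zeta> - z))\<^sup>2) \<le> 3 * max 0 (Re (k \<zeta>))"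
      by blast
  qed
  then show ?thesis by (simp add: field_simps)
qed

section \<open>Growth classes and polynomials\<close>

text \<open>
  A common frame for the two growth classes used below: \<open>\<phi> = (\<lambda>x. x)\<close> gives functions of finite
  order and \<open>\<phi> = exp\<close> functions of finite hyper-order. The last condition makes the classes
  closed under sums and products.
\<close>
definition growth_scale :: "(real \<Rightarrow> real) \<Rightarrow> bool" where
  "growth_scale \<phi> \<longleftrightarrow> mono \<phi> \<and> (\<forall>x\<ge>0. x \<le> \<phi> x) \<and> (\<forall>x\<ge>0. \<forall>y\<ge>0. \<phi> x + \<phi> y + 1 \<le> \<phi> (x + y + 2))"

definition growth_within :: "(real \<Rightarrow> real) \<Rightarrow> (complex \<Rightarrow> complex) \<Rightarrow> bool" where
  "growth_within \<phi> h \<longleftrightarrow> (\<exists>A K. A \<ge> 0 \<and> (\<forall>z. norm (h z) \<le> exp (\<phi> (A * (1 + norm z) ^ K))))"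

definition polynomial_fun :: "(complex \<Rightarrow> complex) \<Rightarrow> bool" where
  "polynomial_fun h \<longleftrightarrow> (\<exists>p. \<forall>z. h z = poly p z)"

lemma growth_scale_id: "growth_scale (\<lambda>x. x)"
  by (auto simp: growth_scale_def mono_def)

lemma growth_scale_exp: "growth_scale exp"
proof -
  have "exp x + exp y + 1 \<le> exp (x + y + 2)" if "x \<ge> 0" "y \<ge> 0" for x y :: real
  proof -
    have "exp x \<le> exp (x + y)" "exp y \<le> exp (x + y)" "1 \<le> exp (x + y)" using that by auto
    then have "exp x + exp y + 1 \<le> exp (x + y) * 3" by linarith
    also have "\<dots> \<le> exp (x + y) * exp 2" using exp_ge_add_one_self[of 2] by (intro mult_left_mono) auto
    finally show ?thesis by (simp add: exp_add)
  qed
  moreover have "x \<le> exp x" for x :: real using exp_ge_add_one_self[of x] by linarith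
  ultimately show ?thesis by (auto simp: growth_scale_def mono_def)
qed

lemma growth_bound_combine:
  fixes r :: real
  assumes "r \<ge> 0" "A \<ge> 0" "B \<ge> 0" "c \<ge> 0"
  shows "A * (1 + r) ^ K + B * (1 + r) ^ L + c \<le> (A + B + c) * (1 + r) ^ (K + L)"
proof -
  have "(1 + r) ^ K \<le> (1 + r) ^ (K + L)" "(1 + r) ^ L \<le> (1 + r) ^ (K + L)" "1 \<le> (1 + r) ^ (K + L)"
    using assms by (auto intro!: power_increasing one_le_power)
  then have "A * (1 + r) ^ K \<le> A * (1 + r) ^ (K + L)" "B * (1 + r) ^ L \<le> B * (1 + r) ^ (K + L)"
    "c * 1 \<le> c * (1 + r) ^ (K + L)"
    using assms by (blast intro: mult_left_mono)+
  then show ?thesis by (simp add: algebra_simps)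
qed

text \<open>
  The hypothesis on \<open>h\<close> is what a sum and a product of \<open>f\<close> and \<open>g\<close> have in common.
\<close>
lemma growth_within_dominated:
  assumes \<phi>: "growth_scale \<phi>" and f: "growth_within \<phi> f" and g: "growth_within \<phi> g"
    and h: "\<And>z x y. norm (f z) \<le> exp x \<Longrightarrow> norm (g z) \<le> exp y \<Longrightarrow> x \<ge> 0 \<Longrightarrow> y \<ge> 0 \<Longrightarrow> norm (h z) \<le> exp (x + y + 1)"
  shows "growth_within \<phi> h"
proof -
  obtain A K where A: "A \<ge> 0" "\<And>z. norm (f z) \<le> exp (\<phi> (A * (1 + norm z) ^ K))"
    using f by (auto simp: growth_within_def)
  obtain B L where B: "B \<ge> 0" "\<And>z. norm (g z) \<le> exp (\<phi> (B * (1 + norm z) ^ L))"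
    using g by (auto simp: growth_within_def)
  have "norm (h z) \<le> exp (\<phi> ((A + B + 2) * (1 + norm z) ^ (K + L)))" for z
  proof -
    let ?x = "A * (1 + norm z) ^ K" and ?y = "B * (1 + norm z) ^ L"
    have xy: "?x \<ge> 0" "?y \<ge> 0" using A(1) B(1) by auto
    then have "\<phi> ?x \<ge> 0" "\<phi> ?y \<ge> 0" using \<phi> by (auto simp: growth_scale_def intro: order_trans)
    then have "norm (h z) \<le> exp (\<phi> ?x + \<phi> ?y + 1)" using h A(2) B(2) by blast
    also have "\<phi> ?x + \<phi> ?y + 1 \<le> \<phi> (?x + ?y + 2)" using xy \<phi> unfolding growth_scale_def by blast
    also have "?x + ?y + 2 \<le> (A + B + 2) * (1 + norm z) ^ (K + L)"
      by (rule growth_bound_combine) (use A(1) B(1) in auto)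
    then have "\<phi> (?x + ?y + 2) \<le> \<phi> \<dots>" using \<phi> unfolding growth_scale_def mono_def by blast
    finally show ?thesis by simp
  qed
  then show ?thesis unfolding growth_within_def using A(1) B(1)
    by (intro exI[of _ "A + B + 2"] exI[of _ "K + L"]) auto
qed

lemma growth_within_add:
  assumes "growth_scale \<phi>" "growth_within \<phi> f" "growth_within \<phi> g"
  shows "growth_within \<phi> (\<lambda>z. f z + g z)"
proof (rule growth_within_dominated[OF assms])
  fix z and x y :: real
  assume b: "norm (f z) \<le> exp x" "norm (g z) \<le> exp y" and xy: "x \<ge> 0" "y \<ge> 0"
  have "norm (f z + g z) \<le> exp x + exp y" using b norm_triangle_ineq[of "f z" "g z"] by linarith
  also have "\<dots> \<le> exp (x + y) * 2"
  proof -
    have "exp x \<le> exp (x + y)" "exp y \<le> exp (x + y)" using xy by auto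
    then show ?thesis by linarith
  qed
  also have "\<dots> \<le> exp (x + y) * exp 1" using exp_ge_add_one_self[of 1] by (intro mult_left_mono) auto
  finally show "norm (f z + g z) \<le> exp (x + y + 1)" by (simp add: exp_add)
qed

lemma growth_within_mult:
  assumes "growth_scale \<phi>" "growth_within \<phi> f" "growth_within \<phi> g"
  shows "growth_within \<phi> (\<lambda>z. f z * g z)"
proof (rule growth_within_dominated[OF assms])
  fix z and x y :: real
  assume b: "norm (f z) \<le> exp x" "norm (g z) \<le> exp y"
  have "norm (f z * g z) \<le> exp x * exp y" unfolding norm_mult using b by (intro mult_mono) auto
  also have "\<dots> \<le> exp (x + y + 1)" by (simp flip: exp_add)
  finally show "norm (f z * g z) \<le> exp (x + y + 1)" .
qed

lemma growth_within_le:
  assumes "growth_within \<phi> g" "\<And>z. norm (h z) \<le> norm (g z)"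
  shows "growth_within \<phi> h"
  using assms unfolding growth_within_def by (meson order_trans)

lemma growth_withinI:
  assumes \<phi>: "growth_scale \<phi>" and "A \<ge> 0" "\<And>z. norm (h z) \<le> exp (A * (1 + norm z) ^ K)"
  shows "growth_within \<phi> h"
proof -
  have "A * (1 + norm z) ^ K \<le> \<phi> (A * (1 + norm z) ^ K)" for z :: complex
    using \<phi> \<open>A \<ge> 0\<close> by (auto simp: growth_scale_def)
  then have "norm (h z) \<le> exp (\<phi> (A * (1 + norm z) ^ K))" for z
    using assms(3)[of z] by (meson exp_le_cancel_iff order_trans)
  then show ?thesis unfolding growth_within_def using assms(2) by blast
qed

lemma growth_within_const: assumes "growth_scale \<phi>" shows "growth_within \<phi> (\<lambda>_. c)"
proof (rule growth_withinI[OF assms, where A = "norm c" and K = 0])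
  show "norm c \<le> exp (norm c * (1 + norm z) ^ 0)" for z :: complex
    using exp_ge_add_one_self[of "norm c"] by (simp del: exp_ge_add_one_self)
qed auto

lemma growth_within_ident: assumes "growth_scale \<phi>" shows "growth_within \<phi> (\<lambda>z. z)"
proof (rule growth_withinI[OF assms, where A = 1 and K = 1])
  show "norm z \<le> exp (1 * (1 + norm z) ^ 1)" for z :: complex
    using exp_ge_add_one_self[of "1 + norm z"] norm_ge_zero[of z] by (simp del: exp_ge_add_one_self)
qed auto

lemma growth_within_minus:
  assumes "growth_scale \<phi>" "growth_within \<phi> f" "growth_within \<phi> g"
  shows "growth_within \<phi> (\<lambda>z. f z - g z)"
  using growth_within_add[OF assms(1,2) growth_within_mult[OF assms(1) growth_within_const[OF assms(1), of "-1"] assms(3)]]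
  by simp

lemma growth_within_power:
  assumes "growth_scale \<phi>" "growth_within \<phi> f"
  shows "growth_within \<phi> (\<lambda>z. f z ^ n)"
  by (induction n) (auto intro: growth_within_const growth_within_mult assms)

text \<open>
  Cauchy's inequality on discs of radius 1.
\<close>
lemma growth_within_deriv:
  assumes \<phi>: "growth_scale \<phi>" and hol: "h holomorphic_on UNIV" and h: "growth_within \<phi> h"
  shows "growth_within \<phi> (deriv h)"
proof -
  obtain A K where A: "A \<ge> 0" "\<And>z. norm (h z) \<le> exp (\<phi> (A * (1 + norm z) ^ K))"
    using h by (auto simp: growth_within_def)
  have "norm (deriv h z) \<le> exp (\<phi> (A * 2 ^ K * (1 + norm z) ^ K))" for z
  proof -
    have "norm ((deriv ^^ 1) h z) \<le> fact 1 * exp (\<phi> (A * 2 ^ K * (1 + norm z) ^ K)) / 1 ^ 1"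
    proof (rule Cauchy_inequality)
      fix w assume "norm (z - w) = 1"
      then have "norm w \<le> norm z + 1" using norm_triangle_ineq4[of z "z - w"] by simp
      then have "1 + norm w \<le> 2 * (1 + norm z)" using norm_ge_zero[of z] unfolding distrib_left by linarith
      then have "(1 + norm w) ^ K \<le> (2 * (1 + norm z)) ^ K" by (intro power_mono) auto
      then have "A * (1 + norm w) ^ K \<le> A * 2 ^ K * (1 + norm z) ^ K"
        using A(1) unfolding mult.assoc power_mult_distrib[symmetric] by (intro mult_left_mono)
      then have "\<phi> (A * (1 + norm w) ^ K) \<le> \<phi> (A * 2 ^ K * (1 + norm z) ^ K)"
        using \<phi> by (auto simp: growth_scale_def mono_def)
      then show "norm (h w) \<le> exp (\<phi> (A * 2 ^ K * (1 + norm z) ^ K))"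
        using A(2)[of w] by (meson exp_le_cancel_iff order_trans)
    qed (auto intro: holomorphic_on_subset[OF hol] holomorphic_on_imp_continuous_on)
    then show ?thesis by simp
  qed
  then show ?thesis unfolding growth_within_def using A(1)
    by (intro exI[of _ "A * 2 ^ K"] exI[of _ K]) auto
qed

lemma growth_within_antideriv:
  assumes \<phi>: "growth_scale \<phi>" and hol: "h holomorphic_on UNIV" and h: "growth_within \<phi> (deriv h)"
  shows "growth_within \<phi> h"
proof -
  obtain A K where A: "A \<ge> 0" "\<And>z. norm (deriv h z) \<le> exp (\<phi> (A * (1 + norm z) ^ K))"
    using h by (auto simp: growth_within_def)
  define g :: "complex \<Rightarrow> complex" where "g = (\<lambda>z. of_real (exp (\<phi> (A * (1 + norm z) ^ K))))"
  have g: "growth_within \<phi> g" unfolding growth_within_def g_def using A(1) by auto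
  have bd: "norm (h z) \<le> norm (h 0) + norm z * norm (g z)" for z
  proof -
    have "norm (h z - h 0) \<le> exp (\<phi> (A * (1 + norm z) ^ K)) * norm (z - 0)"
    proof (rule field_differentiable_bound[of "cball 0 (norm z)" h "deriv h"])
      show "(h has_field_derivative deriv h w) (at w within cball 0 (norm z))" for w
        using hol by (meson UNIV_I has_field_derivative_at_within holomorphic_derivI open_UNIV)
      fix w :: complex assume "w \<in> cball 0 (norm z)"
      then have "(1 + norm w) ^ K \<le> (1 + norm z) ^ K" by (intro power_mono) auto
      then have "A * (1 + norm w) ^ K \<le> A * (1 + norm z) ^ K" using A(1) by (intro mult_left_mono)
      then have "\<phi> (A * (1 + norm w) ^ K) \<le> \<phi> (A * (1 + norm z) ^ K)"
        using \<phi> by (auto simp: growth_scale_def mono_def)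
      then show "norm (deriv h w) \<le> exp (\<phi> (A * (1 + norm z) ^ K))"
        using A(2)[of w] by (meson exp_le_cancel_iff order_trans)
    qed auto
    then have "norm (h z - h 0) \<le> norm z * norm (g z)" by (simp add: g_def mult.commute)
    then show ?thesis using norm_triangle_sub[of "h z" "h 0"] by linarith
  qed
  have 1: "growth_within \<phi> (\<lambda>z. complex_of_real (norm z))"
    by (rule growth_within_le[OF growth_within_ident[OF \<phi>]]) simp
  have "growth_within \<phi> (\<lambda>z. complex_of_real (norm (h 0)) + complex_of_real (norm z) * g z)"
    by (intro growth_within_add growth_within_mult growth_within_const \<phi> 1 g)
  then show ?thesis
  proof (rule growth_within_le)
    fix z
    have "complex_of_real (norm (h 0)) + complex_of_real (norm z) * g z =
        complex_of_real (norm (h 0) + norm z * norm (g z))"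
      by (simp add: g_def)
    then have "norm (complex_of_real (norm (h 0)) + complex_of_real (norm z) * g z) =
        norm (h 0) + norm z * norm (g z)"
      by (metis abs_of_nonneg add_nonneg_nonneg mult_nonneg_nonneg norm_ge_zero norm_of_real)
    then show "norm (h z) \<le> norm (complex_of_real (norm (h 0)) + complex_of_real (norm z) * g z)"
      using bd by simp
  qed
qed

lemma polynomial_fun_add: "polynomial_fun f \<Longrightarrow> polynomial_fun g \<Longrightarrow> polynomial_fun (\<lambda>z. f z + g z)"
  unfolding polynomial_fun_def by (metis poly_add)

lemma polynomial_fun_minus: "polynomial_fun f \<Longrightarrow> polynomial_fun g \<Longrightarrow> polynomial_fun (\<lambda>z. f z - g z)"
  unfolding polynomial_fun_def by (metis poly_diff)

lemma polynomial_fun_mult: "polynomial_fun f \<Longrightarrow> polynomial_fun g \<Longrightarrow> polynomial_fun (\<lambda>z. f z * g z)"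
  unfolding polynomial_fun_def by (metis poly_mult)

lemma polynomial_fun_power: "polynomial_fun f \<Longrightarrow> polynomial_fun (\<lambda>z. f z ^ n)"
  unfolding polynomial_fun_def by (metis poly_power)

lemma polynomial_fun_const: "polynomial_fun (\<lambda>_. c)"
  unfolding polynomial_fun_def by (intro exI[of _ "[:c:]"]) simp

lemma polynomial_fun_deriv:
  assumes "polynomial_fun f" shows "polynomial_fun (deriv f)"
proof -
  obtain p where p: "f = poly p" using assms by (auto simp: polynomial_fun_def)
  have "deriv f z = poly (pderiv p) z" for z
    unfolding p by (rule DERIV_imp_deriv) (rule poly_DERIV)
  then show ?thesis unfolding polynomial_fun_def by blast
qed

lemma polynomial_fun_if_growth:
  assumes "f holomorphic_on UNIV" and bd: "\<And>z. norm (f z) \<le> A * (1 + norm z) ^ K"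
  shows "polynomial_fun f"
proof -
  have A: "A \<ge> 0" using order_trans[OF norm_ge_zero bd[of 0]] by simp
  have "norm (f z) \<le> (A * 2 ^ K) * norm z ^ K" if "1 \<le> norm z" for z
  proof -
    have "(1 + norm z) ^ K \<le> (2 * norm z) ^ K" using that by (intro power_mono) auto
    then have "A * (1 + norm z) ^ K \<le> A * (2 * norm z) ^ K" using A by (rule mult_left_mono)
    then show ?thesis using bd[of z] by (simp add: power_mult_distrib mult.assoc)
  qed
  then have "f \<xi> = (\<Sum>k\<le>K. (deriv ^^ k) f 0 / fact k * \<xi> ^ k)" for \<xi>
    by (rule Liouville_polynomial[OF assms(1)])
  then have "f \<xi> = poly (\<Sum>k\<le>K. monom ((deriv ^^ k) f 0 / fact k) k) \<xi>" for \<xi>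
    by (simp add: poly_sum poly_monom)
  then show ?thesis unfolding polynomial_fun_def by blast
qed

lemma growth_within_polynomial_exp:
  assumes "polynomial_fun \<alpha>"
  shows "growth_within (\<lambda>x. x) (\<lambda>z. exp (\<alpha> z))"
proof -
  obtain p where p: "\<alpha> = poly p" using assms by (auto simp: polynomial_fun_def)
  have "\<exists>A K. A \<ge> 0 \<and> (\<forall>z. norm (poly p z) \<le> A * (1 + norm z) ^ K)" for p :: "complex poly"
  proof (induction p)
    case 0
    show ?case by (intro exI[of _ 0] exI[of _ 0]) auto
  next
    case (pCons c p)
    then obtain A K where A: "A \<ge> 0" "\<And>z. norm (poly p z) \<le> A * (1 + norm z) ^ K" by blast
    have "norm (poly (pCons c p) z) \<le> (norm c + A) * (1 + norm z) ^ Suc K" for z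
    proof -
      have "norm (poly (pCons c p) z) \<le> norm c + norm z * norm (poly p z)"
        by (simp add: norm_triangle_le norm_mult)
      also have "norm z * norm (poly p z) \<le> (1 + norm z) * (A * (1 + norm z) ^ K)"
        using A by (intro mult_mono) auto
      also have "norm c \<le> norm c * (1 + norm z) ^ Suc K"
        using mult_left_mono[of 1 "(1 + norm z) ^ Suc K" "norm c"] one_le_power[of "1 + norm z" "Suc K"] by simp
      finally show ?thesis by (simp add: algebra_simps)
    qed
    then show ?case using A(1) by (intro exI[of _ "norm c + A"] exI[of _ "Suc K"]) auto
  qed
  then obtain A K where A: "A \<ge> 0" "\<And>z. norm (poly p z) \<le> A * (1 + norm z) ^ K" by blast
  have "norm (exp (\<alpha> z)) \<le> exp (A * (1 + norm z) ^ K)" for z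
  proof -
    have "norm (exp (\<alpha> z)) \<le> exp (norm (\<alpha> z))" by (rule norm_exp)
    also have "\<dots> \<le> exp (A * (1 + norm z) ^ K)" using A(2) by (simp add: p)
    finally show ?thesis .
  qed
  then show ?thesis by (rule growth_withinI[OF growth_scale_id A(1)])
qed

section \<open>Functions vanishing where an exponential equals one\<close>

text \<open>
  Divide by the linear factors of the zeros and use the maximum principle on the disc of radius
  \<open>3r\<close>: on its boundary each factor has modulus at least \<open>2r\<close>, at the centre at most \<open>r\<close>.
\<close>
lemma two_power_card_zeros_le:
  assumes E: "E holomorphic_on UNIV" and c: "E c \<noteq> 0" and r: "r > 0"
    and M: "\<And>z. norm (z - c) = 3 * r \<Longrightarrow> norm (E z) \<le> M"
  shows "2 ^ card {z \<in> cball c r. E z = 0} * norm (E c) \<le> M"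
proof -
  define S where "S = {z \<in> cball c r. E z = 0}"
  define N where "N = card S"
  have "finite S" unfolding S_def using entire_finite_zeros[OF E] c by blast
  then have "\<exists>g. g holomorphic_on UNIV \<and> (\<forall>z\<in>UNIV. E z = g z * (\<Prod>s\<in>S. z - s))"
    using E c by (intro holomorphic_factor_finite_zeros) (auto simp: S_def)
  then obtain g where g: "g holomorphic_on UNIV" "\<And>z. E z = g z * (\<Prod>s\<in>S. z - s)" by blast
  have "norm (g c) \<le> M / (2 * r) ^ N"
  proof (rule maximum_modulus_frontier[of g "cball c (3 * r)"])
    fix z assume "z \<in> frontier (cball c (3 * r))"
    then have z: "norm (z - c) = 3 * r" using r by (simp add: frontier_cball dist_norm norm_minus_commute)
    have "(2 * r) ^ N = (\<Prod>s\<in>S. 2 * r)" by (simp add: N_def)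
    also have "\<dots> \<le> (\<Prod>s\<in>S. norm (z - s))"
    proof (rule prod_mono)
      fix s assume "s \<in> S"
      then have "norm (s - c) \<le> r" by (simp add: S_def dist_norm norm_minus_commute)
      then have "2 * r \<le> norm (z - s)" using norm_triangle_ineq[of "z - s" "s - c"] z by simp
      then show "0 \<le> 2 * r \<and> 2 * r \<le> norm (z - s)" using r by simp
    qed
    finally have "norm (g z) * (2 * r) ^ N \<le> norm (g z) * (\<Prod>s\<in>S. norm (z - s))"
      by (rule mult_left_mono) auto
    also have "\<dots> = norm (E z)" by (simp add: g(2) norm_mult prod_norm)
    also have "\<dots> \<le> M" using M z by blast
    finally show "norm (g z) \<le> M / (2 * r) ^ N" using r by (simp add: pos_le_divide_eq)
  qed (use r in \<open>auto intro: holomorphic_on_subset[OF g(1)] holomorphic_on_imp_continuous_on\<close>)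
  then have gc: "norm (g c) * (2 * r) ^ N \<le> M" using r by (simp add: pos_le_divide_eq)
  have "norm (E c) = norm (g c) * (\<Prod>s\<in>S. norm (c - s))" by (simp add: g(2) norm_mult prod_norm)
  also have "\<dots> \<le> norm (g c) * (\<Prod>s\<in>S. r)"
    by (intro mult_left_mono prod_mono) (auto simp: S_def dist_norm)
  finally have "norm (E c) \<le> norm (g c) * r ^ N" by (simp add: N_def)
  then have "2 ^ N * norm (E c) \<le> 2 ^ N * (norm (g c) * r ^ N)" by (intro mult_left_mono) auto
  also have "\<dots> \<le> M" using gc by (simp add: power_mult_distrib mult_ac)
  finally show ?thesis by (simp add: N_def S_def)
qed

lemma card_zeros_polynomially_bounded:
  assumes E: "E holomorphic_on UNIV" "\<exists>w. E w \<noteq> 0" and gr: "growth_within (\<lambda>x. x) E"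
  obtains A K where "A \<ge> 0" "\<And>r. r \<ge> 0 \<Longrightarrow> real (card {z \<in> cball 0 r. E z = 0}) \<le> A * (1 + r) ^ K"
proof -
  obtain c where c: "E c \<noteq> 0" using E(2) by blast
  obtain A K where A: "A \<ge> 0" "\<And>z. norm (E z) \<le> exp (A * (1 + norm z) ^ K)"
    using gr by (auto simp: growth_within_def)
  define D where "D = max 0 (- ln (norm (E c)))"
  define B where "B = 2 * (A * (4 + 4 * norm c) ^ K + D)"
  have "real (card {z \<in> cball 0 r. E z = 0}) \<le> B * (1 + r) ^ K" if r: "r \<ge> 0" for r
  proof -
    define r' where "r' = r + norm c + 1"
    have r': "r' > 0" using r by (simp add: r'_def add_nonneg_pos)
    define N where "N = card {z \<in> cball c r'. E z = 0}"
    define L where "L = A * ((4 + 4 * norm c) * (1 + r)) ^ K"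
    have "{z \<in> cball 0 r. E z = 0} \<subseteq> {z \<in> cball c r'. E z = 0}"
    proof safe
      fix z :: complex assume "z \<in> cball 0 r"
      then show "z \<in> cball c r'" using norm_triangle_ineq4[of c z] by (simp add: dist_norm r'_def)
    qed
    then have "card {z \<in> cball 0 r. E z = 0} \<le> N"
      unfolding N_def by (intro card_mono entire_finite_zeros E)
    moreover have "2 ^ N * norm (E c) \<le> exp L"
      unfolding N_def
    proof (rule two_power_card_zeros_le[OF E(1) c r'])
      fix z assume z: "norm (z - c) = 3 * r'"
      have "norm z \<le> norm (z - c) + norm c" using norm_triangle_ineq[of "z - c" c] by simp
      also have "\<dots> = 3 * r + 4 * norm c + 3" using z by (simp add: r'_def)
      finally have nz: "norm z \<le> 3 * r + 4 * norm c + 3" .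
      have "1 + norm z \<le> (4 + 4 * norm c) * (1 + r)"
      proof -
        have "(4 + 4 * norm c) * (1 + r) = 4 + 4 * r + 4 * norm c + 4 * (norm c * r)"
          by (simp add: algebra_simps)
        moreover have "0 \<le> norm c * r" using r by simp
        ultimately show ?thesis using nz r by linarith
      qed
      then have "A * (1 + norm z) ^ K \<le> L" unfolding L_def
        using A(1) by (intro mult_left_mono power_mono) auto
      then show "norm (E z) \<le> exp L" using A(2)[of z] by (meson exp_le_cancel_iff order_trans)
    qed
    then have "ln (2 ^ N * norm (E c)) \<le> ln (exp L)" using c by (subst ln_le_cancel_iff) auto
    then have "N * ln 2 \<le> L + D" using c by (simp add: ln_mult ln_realpow D_def)
    moreover have "real N * (1 / 2) \<le> N * ln 2"
      using ln2_ge_two_thirds by (intro mult_left_mono) auto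
    moreover have "D \<le> D * (1 + r) ^ K" "D \<ge> 0"
      using mult_left_mono[of 1 "(1 + r) ^ K" D] one_le_power[of "1 + r" K] r by (auto simp: D_def)
    moreover have "B * (1 + r) ^ K = 2 * L + 2 * (D * (1 + r) ^ K)"
      unfolding B_def L_def power_mult_distrib by (simp only: distrib_left distrib_right mult.assoc)
    ultimately show ?thesis by linarith
  qed
  moreover have "B \<ge> 0" using A(1) by (auto simp: B_def D_def)
  ultimately show ?thesis using that by blast
qed

lemma exp_two_pi_i_nat: "exp (2 * of_real pi * \<i> * of_nat k) = (1 :: complex)"
proof -
  have "2 * of_real pi * \<i> * of_nat k = of_nat k * (2 * complex_of_real pi * \<i>)" by simp
  then show ?thesis by (simp only: exp_of_nat_mult exp_two_pi_i power_one)
qed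

text \<open>
  Every \<open>k\<close> for which \<open>\<beta>\<close> attains \<open>2\<pi>ik\<close> contributes a zero of \<open>E\<close>, and different \<open>k\<close> contribute
  different zeros.
\<close>
lemma exists_omitted_index:
  fixes \<beta> :: "complex \<Rightarrow> complex" and I :: "nat set"
  assumes fin: "finite I" "finite {z \<in> S. E z = 0}" and E: "\<And>z. exp (\<beta> z) = 1 \<Longrightarrow> E z = 0"
    and card: "card {z \<in> S. E z = 0} < card I"
  obtains k where "k \<in> I" "\<And>z. z \<in> S \<Longrightarrow> \<beta> z \<noteq> 2 * of_real pi * \<i> * of_nat k"
proof (rule ccontr)
  assume "\<not> thesis"
  then have none: "\<And>k. k \<in> I \<Longrightarrow> (\<And>z. z \<in> S \<Longrightarrow> \<beta> z \<noteq> 2 * of_real pi * \<i> * of_nat k) \<Longrightarrow> False"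
    using that by blast
  have *: "\<exists>z\<in>S. \<beta> z = 2 * of_real pi * \<i> * of_nat k" if "k \<in> I" for k
    using none[OF that] by blast
  have "(\<lambda>k. 2 * of_real pi * \<i> * of_nat k) ` I \<subseteq> \<beta> ` {z \<in> S. E z = 0}"
  proof
    fix v assume "v \<in> (\<lambda>k. 2 * of_real pi * \<i> * of_nat k) ` I"
    then obtain k where k: "k \<in> I" "v = 2 * of_real pi * \<i> * of_nat k" by auto
    obtain z where z: "z \<in> S" "\<beta> z = 2 * of_real pi * \<i> * of_nat k" using *[OF k(1)] by blast
    then have "exp (\<beta> z) = 1" by (simp only: exp_two_pi_i_nat)
    then show "v \<in> \<beta> ` {z \<in> S. E z = 0}" using E z k by (auto intro!: image_eqI[of _ _ z])
  qed
  then have "card ((\<lambda>k. 2 * of_real pi * \<i> * of_nat k) ` I) \<le> card (\<beta> ` {z \<in> S. E z = 0})"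
    using fin(2) by (intro card_mono) auto
  also have "\<dots> \<le> card {z \<in> S. E z = 0}" by (rule card_image_le[OF fin(2)])
  also have "card ((\<lambda>k. 2 * complex_of_real pi * \<i> * of_nat k) ` I) = card I"
    by (rule card_image) (auto simp: inj_on_def)
  finally show False using card by simp
qed

text \<open>
  On the disc of radius \<open>r\<close> let \<open>N\<close> be the number of zeros of \<open>E\<close>, which is polynomially bounded in
  \<open>r\<close>. Among more than \<open>N\<close> values \<open>2\<pi>ik\<close> at least one is omitted by \<open>\<beta>\<close> on that disc. Two omitted
  values of size and distance comparable to \<open>N\<close> allow rescaling \<open>\<beta>\<close> to a function omitting 0 and 1
  whose value at the centre is bounded independently of \<open>r\<close>. Schottky's theorem then bounds \<open>\<beta>\<close> by a constant
  times \<open>N\<close> on half the disc, and Liouville's theorem applies. Choosing the two values at distance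
  comparable to \<open>N\<close> is essential, as Schottky's bound is doubly exponential in the value at the
  centre.
\<close>
lemma polynomial_if_few_exp_ones:
  assumes b: "\<beta> holomorphic_on UNIV" and E: "E holomorphic_on UNIV" "\<exists>w. E w \<noteq> 0"
    and gr: "growth_within (\<lambda>x. x) E" and z1: "\<And>z. exp (\<beta> z) = 1 \<Longrightarrow> E z = 0"
  shows "polynomial_fun \<beta>"
proof -
  obtain A K where A: "A \<ge> 0" "\<And>r. r \<ge> 0 \<Longrightarrow> real (card {z \<in> cball 0 r. E z = 0}) \<le> A * (1 + r) ^ K"
    using card_zeros_polynomially_bounded[OF E gr] by blast
  define M where "M = exp (pi * exp (pi * (2 + 2 * (norm (\<beta> 0) + 1) + 12 * (1/2) / (1 - 1/2))))"
  have M: "M \<ge> 0" by (simp add: M_def)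
  define B where "B = 6 * pi * (M + 1) * (A * 2 ^ K + 1)"
  have "norm (\<beta> z) \<le> B * (1 + norm z) ^ K" for z
  proof -
    define r where "r = 2 * norm z + 1"
    have r: "r > 0" by (simp add: r_def add_nonneg_pos)
    define N where "N = card {z \<in> cball 0 r. E z = 0}"
    have fin: "finite {z \<in> cball 0 r. E z = 0}" by (rule entire_finite_zeros[OF E])
    obtain k where k: "k \<in> {1..N+1}" "\<And>z. z \<in> cball 0 r \<Longrightarrow> \<beta> z \<noteq> 2 * of_real pi * \<i> * of_nat k"
      using exists_omitted_index[of "{1..N+1}" "cball 0 r" E \<beta>] fin z1 unfolding N_def by auto
    \<comment> \<open>again more than \<open>N\<close> indices, now at distance at least \<open>N + 1\<close> from the first range\<close>
    obtain m where m: "m \<in> {2*N+2..3*N+3}" "\<And>z. z \<in> cball 0 r \<Longrightarrow> \<beta> z \<noteq> 2 * of_real pi * \<i> * of_nat m"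
      using exists_omitted_index[of "{2*N+2..3*N+3}" "cball 0 r" E \<beta>] fin z1 unfolding N_def by auto
    define p where "p = 2 * complex_of_real pi * \<i> * of_nat k"
    define q where "q = 2 * complex_of_real pi * \<i> * of_nat m"
    have "q - p = 2 * complex_of_real pi * \<i> * of_real (real m - real k)"
      by (simp add: p_def q_def algebra_simps)
    then have nqp: "norm (q - p) = 2 * pi * (real m - real k)"
      using k m by (simp add: norm_mult del: of_real_diff)
    have np: "norm p = 2 * pi * k" by (simp add: p_def norm_mult)
    have km: "real N + 1 \<le> real m - real k" "real m - real k \<le> 3 * real N + 3" "real k \<le> real N + 1"
      using k m by auto
    have qp0: "norm (q - p) > 0" using km unfolding nqp by simp
    then have qp: "q - p \<noteq> 0" by auto
    \<comment> \<open>rescaled so that the omitted values \<open>p\<close> and \<open>q\<close> become 0 and 1\<close>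
    define g where "g = (\<lambda>w. (\<beta> (of_real r * w) - p) / (q - p))"
    define w where "w = z / of_real r"
    have rw: "of_real r * w = z" using r by (simp add: w_def)
    have "norm (g w) \<le> M"
      unfolding M_def
    proof (rule Schottky[of g])
      show "g holomorphic_on cball 0 1"
        unfolding g_def by (intro holomorphic_intros holomorphic_on_compose_gen[OF _ b, unfolded o_def]) (use qp in auto)
      have "norm (\<beta> 0 - p) \<le> norm (\<beta> 0) + 2 * pi * real k" using norm_triangle_ineq4[of "\<beta> 0" p] np by simp
      also have "\<dots> \<le> norm (\<beta> 0) * norm (q - p) + norm (q - p)"
      proof (rule add_mono)
        show "2 * pi * real k \<le> norm (q - p)" unfolding nqp using km by (intro mult_left_mono) auto
        have "2 * pi * 1 \<le> norm (q - p)" unfolding nqp using km by (intro mult_left_mono) auto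
        then have "1 \<le> norm (q - p)" using pi_gt3 by linarith
        then show "norm (\<beta> 0) \<le> norm (\<beta> 0) * norm (q - p)"
          using mult_left_mono[of 1 "norm (q - p)" "norm (\<beta> 0)"] by simp
      qed
      finally show "norm (g 0) \<le> norm (\<beta> 0) + 1"
        using qp0 by (simp add: g_def norm_divide pos_divide_le_eq algebra_simps)
      show "norm w \<le> 1 / 2"
        using r by (simp add: w_def norm_divide pos_divide_le_eq) (simp add: r_def)
      fix x :: complex assume "x \<in> cball 0 1"
      then have "of_real r * x \<in> cball 0 r" using r by (simp add: norm_mult)
      then have "\<beta> (of_real r * x) \<noteq> p" "\<beta> (of_real r * x) \<noteq> q" using k m by (auto simp: p_def q_def)
      then show "\<not> (g x = 0 \<or> g x = 1)" using qp by (auto simp: g_def)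
    qed auto
    then have "norm (\<beta> z - p) \<le> M * norm (q - p)"
      using qp0 by (simp add: g_def rw norm_divide pos_divide_le_eq)
    also have "\<dots> \<le> M * (2 * pi * (3 * real N + 3))"
      unfolding nqp using km M by (intro mult_left_mono) auto
    finally have "norm (\<beta> z) \<le> M * (2 * pi * (3 * real N + 3)) + 2 * pi * (3 * real N + 3)"
    proof -
      assume a: "norm (\<beta> z - p) \<le> M * (2 * pi * (3 * real N + 3))"
      have "2 * pi * real k \<le> 2 * pi * (3 * real N + 3)" using km by (intro mult_left_mono) auto
      then show ?thesis using a norm_triangle_sub[of "\<beta> z" p] np by linarith
    qed
    also have "\<dots> = 6 * pi * (M + 1) * (real N + 1)" by (simp add: algebra_simps)
    also have "\<dots> \<le> 6 * pi * (M + 1) * ((A * 2 ^ K + 1) * (1 + norm z) ^ K)"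
    proof (rule mult_left_mono)
      have "real N \<le> A * (1 + r) ^ K" unfolding N_def using A(2)[of r] r by simp
      also have "1 + r = 2 * (1 + norm z)" by (simp add: r_def)
      finally have "real N \<le> A * 2 ^ K * (1 + norm z) ^ K" unfolding power_mult_distrib mult.assoc .
      moreover have "1 \<le> (1 + norm z) ^ K" by (rule one_le_power) simp
      ultimately show "real N + 1 \<le> (A * 2 ^ K + 1) * (1 + norm z) ^ K"
        unfolding distrib_right by linarith
    qed (use M in simp)
    finally show ?thesis by (simp add: B_def mult.assoc)
  qed
  then show ?thesis by (rule polynomial_fun_if_growth[OF b])
qed

text \<open>
  If \<open>E\<close> were not identically zero, then \<open>\<beta>\<close> and hence \<open>E\<close> would be polynomials; but a
  non-constant polynomial \<open>\<beta>\<close> attains all the values \<open>2\<pi>ik\<close>, which gives \<open>E\<close> infinitely many zeros.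
\<close>
lemma vanishing_where_exp_is_one:
  assumes b: "\<beta> holomorphic_on UNIV" and nc: "\<not> (\<exists>c. \<forall>z. \<beta> z = c)"
    and E: "E holomorphic_on UNIV" and gr: "growth_within (\<lambda>x. x) E"
    and pol: "polynomial_fun \<beta> \<Longrightarrow> polynomial_fun E"
    and z1: "\<And>z. exp (\<beta> z) = 1 \<Longrightarrow> E z = 0"
  shows "E z = 0"
proof (rule ccontr)
  assume "E z \<noteq> 0"
  then have nz: "\<exists>w. E w \<noteq> 0" by (rule exI)
  have pb: "polynomial_fun \<beta>" by (rule polynomial_if_few_exp_ones[OF b E nz gr z1])
  then obtain p where p: "\<And>z. \<beta> z = poly p z" unfolding polynomial_fun_def by blast
  obtain q where q: "\<And>z. E z = poly q z" using pol[OF pb] unfolding polynomial_fun_def by blast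
  have "q \<noteq> 0" using \<open>E z \<noteq> 0\<close> q[of z] by auto
  then have "finite {z. poly q z = 0}" by (rule poly_roots_finite)
  then have fin: "finite {z. E z = 0}" by (simp only: q)
  have "degree p > 0"
  proof (rule ccontr)
    assume "\<not> degree p > 0"
    then obtain c where "p = [:c:]" using degree_eq_zeroE by blast
    then have "\<beta> z = c" for z using p by simp
    then show False using nc by blast
  qed
  have ex: "\<exists>z. E z = 0 \<and> \<beta> z = 2 * of_real pi * \<i> * of_nat k" for k
  proof -
    define v where "v = 2 * complex_of_real pi * \<i> * of_nat k"
    have "degree (p + [:- v:]) > 0" using \<open>degree p > 0\<close> by (simp add: degree_add_eq_left)
    then obtain z where "poly (p + [:- v:]) z = 0"
      using alg_closed_imp_poly_has_root[of "p + [:- v:]"] by blast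
    then have "\<beta> z = v" using p[of z] by simp
    then have "\<beta> z = 2 * of_real pi * \<i> * of_nat k" by (simp only: v_def)
    moreover from this have "exp (\<beta> z) = 1" by (simp only: exp_two_pi_i_nat)
    ultimately show ?thesis using z1 by blast
  qed
  have "range (\<lambda>k::nat. 2 * complex_of_real pi * \<i> * of_nat k) \<subseteq> \<beta> ` {z. E z = 0}"
  proof (rule image_subsetI)
    fix k :: nat
    obtain z where "E z = 0" "\<beta> z = 2 * of_real pi * \<i> * of_nat k"
      using ex by blast
    then show "2 * complex_of_real pi * \<i> * of_nat k \<in> \<beta> ` {z. E z = 0}"
      by (intro image_eqI[of _ _ z]) auto
  qed
  then have "finite (range (\<lambda>k::nat. 2 * complex_of_real pi * \<i> * of_nat k))"
    by (rule finite_subset) (rule finite_imageI[OF fin])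
  moreover have "inj (\<lambda>k::nat. 2 * complex_of_real pi * \<i> * of_nat k)" by (auto simp: inj_on_def)
  ultimately have "finite (UNIV :: nat set)" by (rule finite_imageD)
  then show False by simp
qed

section \<open>From the hyper-order to the growth of the exponents\<close>

lemma nevanlinna_T_entire:
  assumes "f holomorphic_on UNIV"
  shows "nevanlinna_T r f = proximity_fun r f"
proof -
  have "\<not> is_pole f z" for z using not_is_pole_holomorphic[OF open_UNIV UNIV_I assms] .
  then have "pole_count t f = 0" for t by (simp add: pole_count_def)
  then show ?thesis by (simp add: nevanlinna_T_def counting_fun_def)
qed

text \<open>
  The case \<open>T \<le> 1\<close> is separate because the iterated logarithm is meaningful only for \<open>T > 1\<close>.
\<close>
lemma nevanlinna_T_le_if_finite_hyper_order:
  assumes "hyper_order f < \<infinity>"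
  obtains K :: nat and r0 where "\<And>r. r \<ge> r0 \<Longrightarrow> nevanlinna_T r f \<le> exp (r ^ K)"
proof -
  obtain K :: nat where "hyper_order f < ereal (real K)"
    using assms less_PInf_Ex_of_nat by auto
  then have "eventually (\<lambda>r. ereal (ln (ln (nevanlinna_T r f)) / ln r) < ereal (real K)) at_top"
    unfolding hyper_order_def by (rule Limsup_lessD)
  then have "eventually (\<lambda>r. ln (ln (nevanlinna_T r f)) / ln r < real K \<and> r > 1) at_top"
    using eventually_gt_at_top[of 1] by eventually_elim simp
  then obtain r0 where r0: "\<And>r. r \<ge> r0 \<Longrightarrow> ln (ln (nevanlinna_T r f)) / ln r < real K \<and> r > 1"
    by (auto simp: eventually_at_top_linorder)
  have "nevanlinna_T r f \<le> exp (r ^ K)" if "r \<ge> r0" for r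
  proof (cases "nevanlinna_T r f \<le> 1")
    case True
    then show ?thesis using r0[OF that] by (intro order_trans[OF True]) auto
  next
    case False
    define L where "L = ln (nevanlinna_T r f)"
    have L: "L > 0" "nevanlinna_T r f = exp L" using False by (auto simp: L_def)
    have r: "r > 1" "ln r > 0" using r0[OF that] by auto
    have "ln L < real K * ln r" using r0[OF that] r by (simp add: L_def divide_less_eq)
    also have "\<dots> = ln (r ^ K)" using r by (simp add: ln_realpow)
    finally have "L < r ^ K" using L r by simp
    then show ?thesis using L by simp
  qed
  then show ?thesis using that by blast
qed

text \<open>
  This is the estimate of \<open>ln |f|\<close> by the characteristic function. The Poisson kernel is at most 3 on the
  half disc, and the positive part of \<open>Re h\<close> on the circle is exactly \<open>log_plus |f|\<close>.
\<close>
lemma norm_le_exp_proximity: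
  assumes f: "f holomorphic_on UNIV" "\<exists>w. f w \<noteq> 0" and R: "R > 0" and z: "norm z \<le> R / 2"
  obtains \<rho> where "R < \<rho>" "\<rho> < 2 * R" "norm (f z) \<le> exp (3 * proximity_fun \<rho> f)"
proof -
  obtain \<rho> T h where \<rho>: "R < \<rho>" "\<rho> < 2 * R" "\<rho> < T" and h: "h holomorphic_on ball 0 T"
    and le: "\<And>z. norm z \<le> \<rho> \<Longrightarrow> norm (f z) \<le> norm (exp (h z))"
    and eq: "\<And>z. norm z = \<rho> \<Longrightarrow> norm (f z) = norm (exp (h z))"
    using entire_zero_free_majorant[OF f R] by metis
  have lp: "log_plus (exp x) = max 0 x" for x by (auto simp: log_plus_def)
  have circ: "max 0 (Re (h (of_real \<rho> * cis t))) = log_plus (norm (f (of_real \<rho> * cis t)))" for t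
    using eq[of "of_real \<rho> * cis t"] R \<rho> by (simp add: norm_mult norm_exp_eq_Re lp)
  have "h holomorphic_on cball 0 \<rho>" by (rule holomorphic_on_subset[OF h]) (use \<rho> in auto)
  then have "Re (h z) \<le> 3 * (1 / (2 * pi) * integral {0..2 * pi} (\<lambda>t. max 0 (Re (h (of_real \<rho> * cis t)))))"
    by (rule poisson_upper_bound) (use z R \<rho> in auto)
  then have "Re (h z) \<le> 3 * proximity_fun \<rho> f" unfolding circ proximity_fun_def .
  moreover have "norm (f z) \<le> exp (Re (h z))" using le[of z] z R \<rho> by (simp add: norm_exp_eq_Re)
  ultimately have "norm (f z) \<le> exp (3 * proximity_fun \<rho> f)" by (meson exp_le_cancel_iff order_trans)
  then show ?thesis using that \<rho> by blast
qed

lemma growth_within_exp_if_finite_hyper_order: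
  assumes f: "f holomorphic_on UNIV" "\<exists>w. f w \<noteq> 0" and ho: "hyper_order f < \<infinity>"
  shows "growth_within exp f"
proof -
  obtain K :: nat and r0 where K: "\<And>r. r \<ge> r0 \<Longrightarrow> nevanlinna_T r f \<le> exp (r ^ K)"
    using nevanlinna_T_le_if_finite_hyper_order[OF ho] by blast
  define s where "s = max 0 r0"
  define A where "A = (4 + 2 * s) ^ K + 2"
  have s: "s \<ge> 0" "s \<ge> r0" by (auto simp: s_def)
  have "norm (f z) \<le> exp (exp (A * (1 + norm z) ^ K))" for z
  proof -
    define R where "R = 2 * norm z + s + 1"
    have "R > 0" using s norm_ge_zero[of z] unfolding R_def by linarith
    moreover have "norm z \<le> R / 2" using s by (simp add: R_def field_simps)
    ultimately have R: "R > 0" "norm z \<le> R / 2" by auto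
    obtain \<rho> where \<rho>: "R < \<rho>" "\<rho> < 2 * R" "norm (f z) \<le> exp (3 * proximity_fun \<rho> f)"
      using norm_le_exp_proximity[OF f R] by blast
    have "2 * R \<le> (4 + 2 * s) * (1 + norm z)"
    proof -
      have "(4 + 2 * s) * (1 + norm z) = 4 + 4 * norm z + 2 * s + 2 * (s * norm z)" by (simp add: algebra_simps)
      moreover have "0 \<le> s * norm z" using s by simp
      moreover have "2 * R = 4 * norm z + 2 * s + 2" by (simp add: R_def)
      ultimately show ?thesis by linarith
    qed
    then have "\<rho> ^ K \<le> ((4 + 2 * s) * (1 + norm z)) ^ K" using \<rho> R by (intro power_mono) auto
    also have "\<dots> = (4 + 2 * s) ^ K * (1 + norm z) ^ K" by (rule power_mult_distrib)
    finally have 1: "\<rho> ^ K \<le> (4 + 2 * s) ^ K * (1 + norm z) ^ K" .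
    have 2: "1 \<le> (1 + norm z) ^ K" by (rule one_le_power) simp
    have "\<rho> \<ge> r0" using \<rho> s norm_ge_zero[of z] unfolding R_def by linarith
    then have "proximity_fun \<rho> f \<le> exp (\<rho> ^ K)" using K nevanlinna_T_entire[OF f(1)] by metis
    then have "3 * proximity_fun \<rho> f \<le> 3 * exp (\<rho> ^ K)" by simp
    also have "\<dots> \<le> exp 2 * exp (\<rho> ^ K)"
      using exp_ge_add_one_self[of 2] by (intro mult_right_mono) auto
    also have "\<dots> = exp (2 + \<rho> ^ K)" by (simp add: exp_add)
    also have "\<dots> \<le> exp (A * (1 + norm z) ^ K)"
      using 1 2 unfolding A_def distrib_right exp_le_cancel_iff by linarith
    finally show ?thesis using \<rho>(3) by (meson exp_le_cancel_iff order_trans)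
  qed
  moreover have "A \<ge> 0" using s by (simp add: A_def)
  ultimately show ?thesis unfolding growth_within_def by blast
qed

text \<open>
  This replaces the usual comparison of characteristics in \<open>F = e\<^sup>\<beta> G\<close>: the exponent grows at
  most like the logarithm of the growth of \<open>F\<close> and \<open>G\<close>.
\<close>
lemma exponent_growth:
  assumes \<phi>: "growth_scale \<phi>" and F: "F holomorphic_on UNIV" and G: "G holomorphic_on UNIV" "\<exists>w. G w \<noteq> 0"
    and b: "\<beta> holomorphic_on UNIV" and FG: "\<And>z. F z = exp (\<beta> z) * G z"
    and gF: "growth_within \<phi> F" and gG: "growth_within \<phi> G"
  obtains A C K where "A \<ge> 0" "C \<ge> 0" "\<And>z. norm (\<beta> z) \<le> 4 * \<phi> (A * (1 + norm z) ^ K) + C"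
proof (rule exponent_bound[OF F G b FG])
  fix C d
  assume d: "d \<ge> 0" and C: "\<And>m z. (\<And>w. norm w \<le> 4 * norm z + d \<Longrightarrow> norm (F w) \<le> exp m) \<Longrightarrow>
     (\<And>w. norm w \<le> 4 * norm z + d \<Longrightarrow> norm (G w) \<le> exp m) \<Longrightarrow> norm (\<beta> z) \<le> 4 * m + C"
  have n: "growth_within \<phi> (\<lambda>z. complex_of_real (norm (h z)))" if "growth_within \<phi> h" for h
    using that by (rule growth_within_le) simp
  have "growth_within \<phi> (\<lambda>z. complex_of_real (norm (F z)) + complex_of_real (norm (G z)))"
    by (intro growth_within_add \<phi> n gF gG)
  then obtain A K where A: "A \<ge> 0"
    "\<And>z. norm (complex_of_real (norm (F z)) + complex_of_real (norm (G z))) \<le> exp (\<phi> (A * (1 + norm z) ^ K))"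
    unfolding growth_within_def by blast
  have A2: "norm (F z) \<le> exp (\<phi> (A * (1 + norm z) ^ K))" "norm (G z) \<le> exp (\<phi> (A * (1 + norm z) ^ K))" for z
  proof -
    have "norm (complex_of_real (norm (F z)) + complex_of_real (norm (G z))) = norm (F z) + norm (G z)"
      by (simp flip: of_real_add)
    then have "norm (F z) + norm (G z) \<le> exp (\<phi> (A * (1 + norm z) ^ K))" using A(2)[of z] by simp
    then show "norm (F z) \<le> exp (\<phi> (A * (1 + norm z) ^ K))" "norm (G z) \<le> exp (\<phi> (A * (1 + norm z) ^ K))"
      using norm_ge_zero[of "F z"] norm_ge_zero[of "G z"] by linarith+
  qed
  have "norm (\<beta> z) \<le> 4 * \<phi> (A * (4 + d) ^ K * (1 + norm z) ^ K) + max 0 C" for z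
  proof -
    have up: "exp (\<phi> (A * (1 + norm w) ^ K)) \<le> exp (\<phi> (A * (4 + d) ^ K * (1 + norm z) ^ K))"
      if "norm w \<le> 4 * norm z + d" for w :: complex
    proof -
      have "(4 + d) * (1 + norm z) = 4 + 4 * norm z + d + d * norm z" by (simp add: algebra_simps)
      moreover have "0 \<le> d * norm z" using d by simp
      ultimately have "1 + norm w \<le> (4 + d) * (1 + norm z)" using that d by linarith
      then have "(1 + norm w) ^ K \<le> ((4 + d) * (1 + norm z)) ^ K" by (intro power_mono) auto
      then have "A * (1 + norm w) ^ K \<le> A * (4 + d) ^ K * (1 + norm z) ^ K"
        using A(1) unfolding mult.assoc power_mult_distrib[symmetric] by (intro mult_left_mono)
      then show ?thesis using \<phi> by (simp add: growth_scale_def mono_def)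
    qed
    have "norm (\<beta> z) \<le> 4 * \<phi> (A * (4 + d) ^ K * (1 + norm z) ^ K) + C"
      by (rule C) (erule order_trans[OF A2(1) up], erule order_trans[OF A2(2) up])
    then show ?thesis by linarith
  qed
  then show ?thesis by (rule that[rotated 2]) (use A(1) d in simp_all)
qed

lemma exponent_finite_order:
  assumes F: "F holomorphic_on UNIV" and G: "G holomorphic_on UNIV" "\<exists>w. G w \<noteq> 0"
    and b: "\<beta> holomorphic_on UNIV" and FG: "\<And>z. F z = exp (\<beta> z) * G z"
    and gF: "growth_within exp F" and gG: "growth_within exp G"
  shows "growth_within (\<lambda>x. x) \<beta>"
proof -
  obtain A C K where A: "A \<ge> 0" and C: "C \<ge> 0"
    and bd: "\<And>z. norm (\<beta> z) \<le> 4 * exp (A * (1 + norm z) ^ K) + C"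
    using exponent_growth[OF growth_scale_exp F G b FG gF gG] by blast
  have "norm (\<beta> z) \<le> exp ((A + (3 + C)) * (1 + norm z) ^ K)" for z
  proof -
    define x where "x = A * (1 + norm z) ^ K"
    have x: "x \<ge> 0" using A by (simp add: x_def)
    have "4 * exp x + C \<le> 4 * exp x + C * exp x" using mult_left_mono[of 1 "exp x" C] C x by simp
    also have "\<dots> = exp x * (1 + (3 + C))" by (simp add: algebra_simps)
    also have "\<dots> \<le> exp x * exp (3 + C)" by (intro mult_left_mono exp_ge_add_one_self) auto
    also have "\<dots> = exp (x + (3 + C))" by (simp add: exp_add)
    also have "x + (3 + C) \<le> (A + (3 + C)) * (1 + norm z) ^ K"
    proof -
      have "(3 + C) * 1 \<le> (3 + C) * (1 + norm z) ^ K" using C by (intro mult_left_mono one_le_power) auto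
      then show ?thesis unfolding x_def distrib_right by linarith
    qed
    finally show ?thesis using bd[of z] unfolding x_def by simp
  qed
  then show ?thesis by (rule growth_withinI[OF growth_scale_id, rotated]) (use A C in simp)
qed

lemma exponent_polynomial:
  assumes F: "F holomorphic_on UNIV" and G: "G holomorphic_on UNIV" "\<exists>w. G w \<noteq> 0"
    and b: "\<beta> holomorphic_on UNIV" and FG: "\<And>z. F z = exp (\<beta> z) * G z"
    and gF: "growth_within (\<lambda>x. x) F" and gG: "growth_within (\<lambda>x. x) G"
  shows "polynomial_fun \<beta>"
proof -
  obtain A C K where A: "A \<ge> 0" and C: "C \<ge> 0"
    and bd: "\<And>z. norm (\<beta> z) \<le> 4 * (A * (1 + norm z) ^ K) + C"
    using exponent_growth[OF growth_scale_id F G b FG gF gG] by blast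
  have "norm (\<beta> z) \<le> (4 * A + C) * (1 + norm z) ^ K" for z
  proof -
    have "C * 1 \<le> C * (1 + norm z) ^ K" using C by (intro mult_left_mono one_le_power) auto
    then show ?thesis using bd[of z] unfolding distrib_right by linarith
  qed
  then show ?thesis by (rule polynomial_fun_if_growth[OF b])
qed

section \<open>The shared values\<close>

lemma entire_same_zeros_quotient:
  assumes F: "F holomorphic_on UNIV" "\<exists>w. F w \<noteq> 0" and G: "G holomorphic_on UNIV" "\<exists>w. G w \<noteq> 0"
    and zeros: "\<And>z. F z = 0 \<longleftrightarrow> G z = 0" and ord: "\<And>z. F z = 0 \<Longrightarrow> zorder F z = zorder G z"
  obtains \<beta> where "\<beta> holomorphic_on UNIV" "\<And>z. F z = exp (\<beta> z) * G z"
proof -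
  have F': "\<exists>w\<in>UNIV. F w \<noteq> 0" and G': "\<exists>w\<in>UNIV. G w \<noteq> 0" using F(2) G(2) by auto
  have ord': "zorder F z = zorder G z" for z
    using ord[of z] zeros[of z] zorder_holomorphic[OF open_UNIV connected_UNIV F(1) F' UNIV_I, of z]
      zorder_holomorphic[OF open_UNIV connected_UNIV G(1) G' UNIV_I, of z]
    by (auto split: if_splits)
  obtain q where q: "q holomorphic_on UNIV" "\<And>z. F z = q z * G z" "\<And>z. q z \<noteq> 0"
    using holomorphic_divide_by_zorder[of UNIV F G] F G ord' by (metis UNIV_I connected_UNIV open_UNIV order_refl)
  obtain \<beta> where "\<beta> holomorphic_on UNIV" "\<And>z. exp (\<beta> z) = q z"
    using holomorphic_logarithm_exists[of UNIV q 0] q by auto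
  then show ?thesis using that q(2) by metis
qed

lemma entire_mult_eq_0:
  assumes f: "f holomorphic_on UNIV" "\<exists>w. f w \<noteq> (0 :: complex)" and g: "g holomorphic_on UNIV"
    and fg: "\<And>z. f z * g z = 0"
  shows "g z = 0"
proof (rule ccontr)
  assume "g z \<noteq> 0"
  then have "finite {z \<in> cball 0 1. g z = 0}" using entire_finite_zeros[OF g] by blast
  moreover have "finite {z \<in> cball 0 1. f z = 0}" using entire_finite_zeros[OF f] by blast
  ultimately have "finite ({z \<in> cball 0 1. f z = 0} \<union> {z \<in> cball 0 1. g z = 0})" by blast
  moreover have "cball 0 1 \<subseteq> {z \<in> cball 0 1. f z = 0} \<union> {z \<in> cball 0 1. g z = 0}" using fg by auto
  ultimately have "finite (cball (0::complex) 1)" using finite_subset by blast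
  moreover have "infinite (cball (0::complex) 1)"
    by (intro uncountable_infinite uncountable_cball) auto
  ultimately show False by blast
qed

lemma square_not_constant:
  fixes f :: "complex \<Rightarrow> complex"
  assumes f: "f holomorphic_on UNIV" and nc: "\<not> (\<exists>c. \<forall>z. deriv f z = c)"
  shows "\<exists>z. f z ^ 2 \<noteq> a"
proof (rule ccontr)
  assume "\<not> ?thesis"
  then have sq: "(\<lambda>z. f z ^ 2) = (\<lambda>_. a)" by auto
  have fnz: "\<exists>w. f w \<noteq> 0"
  proof (rule ccontr)
    assume "\<not> ?thesis"
    then have "f = (\<lambda>_. 0)" by auto
    then show False using nc by auto
  qed
  have "deriv (\<lambda>z. f z ^ 2) z = 2 * f z * deriv f z" for z
    by (rule DERIV_imp_deriv) (auto intro!: derivative_eq_intros holomorphic_derivI[OF f])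
  then have "f z * deriv f z = 0" for z unfolding sq by simp
  then have "deriv f z = 0" for z by (rule entire_mult_eq_0[OF f fnz holomorphic_deriv[OF f open_UNIV]])
  then show False using nc by blast
qed

text \<open>
  Each root of \<open>w\<^sup>n = b\<close> other than \<open>b\<close> is an omitted value of \<open>g\<close>, and so is \<open>b\<close> if
  it is not itself such a root. Picard's theorem allows one omitted value only, which forces
  \<open>n = 2\<close> and \<open>b = 1\<close>.
\<close>
lemma shared_power_omits_minus_one:
  fixes g :: "complex \<Rightarrow> complex"
  assumes g: "g holomorphic_on UNIV" and nc: "\<And>c. g \<noteq> (\<lambda>_. c)" and n: "n \<ge> 2" and b: "b \<noteq> 0"
    and sh: "\<And>z. g z ^ n = b \<longleftrightarrow> g z = b"
  shows "n = 2" "\<And>z. g z \<noteq> -1"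
proof -
  define Rt where "Rt = {w. w ^ n = b}"
  have card: "card Rt = n" unfolding Rt_def using b n by (intro card_nth_roots) auto
  then have fin: "finite Rt" using n by (metis card.infinite not_numeral_le_zero)
  have omit: "g z \<noteq> w" if "w \<in> Rt" "w \<noteq> b" for w z using sh[of z] that by (auto simp: Rt_def)
  have picard: "w = v" if no: "\<And>z. g z \<noteq> w" "\<And>z. g z \<noteq> v" for w v
  proof (rule ccontr)
    assume "w \<noteq> v"
    then obtain c where "g = (\<lambda>_. c)" using little_Picard[OF g, of w v] no by blast
    then show False using nc by blast
  qed
  have bR: "b \<in> Rt"
  proof (rule ccontr)
    assume "b \<notin> Rt"
    then have "w = v" if "w \<in> Rt" "v \<in> Rt" for w v using picard omit that by metis
    then have "card Rt \<le> 1" using card_le_Suc0_iff_eq[OF fin] by auto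
    then show False using card n by simp
  qed
  have "w = v" if "w \<in> Rt - {b}" "v \<in> Rt - {b}" for w v using picard omit that by blast
  then have "card (Rt - {b}) \<le> 1" using card_le_Suc0_iff_eq[of "Rt - {b}"] fin by auto
  then show n2: "n = 2" using card n bR fin by (simp add: card_Diff_singleton)
  have "b = 1" using bR b by (auto simp: Rt_def n2 power2_eq_square)
  then have "-1 \<in> Rt" "-1 \<noteq> b" by (auto simp: Rt_def n2)
  then show "g z \<noteq> -1" for z using omit by blast
qed

text \<open>
  Let \<open>u = exp \<alpha>\<close>. Differentiating the hypothesis gives an identity with left side \<open>2f(u - 1)\<close>, so at the
  points where \<open>u = 1\<close> an expression \<open>P\<close> in the derivatives of \<open>\<alpha>\<close> and \<open>\<beta>\<close> vanishes. It has finite order, so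
  it vanishes identically, and the identity collapses to \<open>2f = a \<beta>' e\<^sup>\<beta>\<close>. Putting this back
  into the hypothesis gives \<open>e\<^sup>2\<^sup>\<beta> E = 2 - 2 e\<^sup>\<beta>\<close>, where \<open>E\<close> is a differential polynomial in \<open>\<beta>\<close>. Now \<open>E\<close>
  vanishes where \<open>e\<^sup>\<beta> = 1\<close>, hence everywhere, so \<open>e\<^sup>\<beta> = 1\<close> identically and \<open>f = 0\<close>.
\<close>
lemma no_entire_sharing_square_and_second_derivative:
  fixes f \<alpha> \<beta> :: "complex \<Rightarrow> complex"
  assumes f: "f holomorphic_on UNIV" and gf: "growth_within exp f" and a: "a \<noteq> 0"
    and al: "\<alpha> holomorphic_on UNIV" and f': "\<And>z. deriv f z = exp (\<alpha> z) - 1"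
    and nc: "\<not> (\<exists>c. \<forall>z. deriv f z = c)"
    and be: "\<beta> holomorphic_on UNIV" and FG: "\<And>z. f z ^ 2 - a = exp (\<beta> z) * (deriv (deriv f) z - a)"
  shows False
proof -
  note gs = growth_scale_id growth_scale_exp
  have hd: "deriv h holomorphic_on UNIV" if "h holomorphic_on UNIV" for h :: "complex \<Rightarrow> complex"
    using that by (rule holomorphic_deriv) auto
  have D: "(h has_field_derivative deriv h z) (at z)" if "h holomorphic_on UNIV" for h z
    using that by (rule holomorphic_derivI) auto
  note Da = D[OF al] D[OF hd[OF al]] D[OF be] D[OF hd[OF be]] D[OF hd[OF hd[OF be]]]
  have f'': "deriv (deriv f) z = deriv \<alpha> z * exp (\<alpha> z)" for z
  proof -
    have "deriv f = (\<lambda>z. exp (\<alpha> z) - 1)" using f' by auto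
    then show ?thesis by (simp only:) (rule DERIV_imp_deriv, auto intro!: derivative_eq_intros Da)
  qed
  define F where "F = (\<lambda>z. f z ^ 2 - a)"
  define G where "G = (\<lambda>z. deriv (deriv f) z - a)"
  have hF: "F holomorphic_on UNIV" unfolding F_def by (intro holomorphic_intros f)
  have hG: "G holomorphic_on UNIV" unfolding G_def by (intro holomorphic_intros hd f)
  have FG': "F z = exp (\<beta> z) * G z" for z using FG by (simp add: F_def G_def)
  have gFG: "growth_within \<phi> F" "growth_within \<phi> G" if "growth_scale \<phi>" "growth_within \<phi> f" for \<phi>
    unfolding F_def G_def
    by (intro growth_within_minus growth_within_power growth_within_const growth_within_deriv hd f that)+
  have fnz: "\<exists>w. f w \<noteq> 0"
  proof (rule ccontr)
    assume "\<not> ?thesis"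
    then have "f = (\<lambda>_. 0)" by auto
    then show False using nc by auto
  qed
  have Gnz: "\<exists>w. G w \<noteq> 0"
  proof (rule ccontr)
    assume "\<not> ?thesis"
    then have "f z ^ 2 = a" for z using FG'[of z] by (simp add: F_def)
    then show False using square_not_constant[OF f nc] by blast
  qed
  have gal: "growth_within (\<lambda>x. x) \<alpha>"
  proof (rule exponent_finite_order[of "\<lambda>z. deriv f z + 1" "\<lambda>_. 1"])
    show "growth_within exp (\<lambda>z. deriv f z + 1)"
      by (intro growth_within_add growth_within_const growth_within_deriv gs gf f)
    show "(\<lambda>z. deriv f z + 1) holomorphic_on UNIV" by (intro holomorphic_intros hd f)
    show "deriv f z + 1 = exp (\<alpha> z) * 1" for z using f' by simp
  qed (use al growth_within_const[OF growth_scale_exp] in auto)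
  have gbe: "growth_within (\<lambda>x. x) \<beta>"
    by (rule exponent_finite_order[OF hF hG Gnz be FG']) (use gFG[OF growth_scale_exp gf] in auto)
  \<comment> \<open>for polynomial \<open>\<alpha>\<close> all growth drops by one exponential, so that \<open>\<beta>\<close> becomes polynomial, too\<close>
  have polbe: "polynomial_fun \<beta>" if "polynomial_fun \<alpha>"
  proof -
    have "growth_within (\<lambda>x. x) (\<lambda>z. exp (\<alpha> z) - 1)"
      by (intro growth_within_minus growth_within_const gs growth_within_polynomial_exp that)
    moreover have "deriv f = (\<lambda>z. exp (\<alpha> z) - 1)" using f' by auto
    ultimately have "growth_within (\<lambda>x. x) (deriv f)" by simp
    then have "growth_within (\<lambda>x. x) f" by (rule growth_within_antideriv[OF growth_scale_id f])
    then show ?thesis using exponent_polynomial[OF hF hG Gnz be FG'] gFG[OF growth_scale_id] by blast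
  qed
  have dF: "2 * f z * (exp (\<alpha> z) - 1) = exp (\<beta> z) * (deriv \<beta> z * (deriv \<alpha> z * exp (\<alpha> z) - a)
      + (deriv (deriv \<alpha>) z + deriv \<alpha> z ^ 2) * exp (\<alpha> z))" for z
  proof -
    have "deriv F z = 2 * f z * deriv f z"
      unfolding F_def by (rule DERIV_imp_deriv) (auto intro!: derivative_eq_intros D f)
    moreover have "F = (\<lambda>z. exp (\<beta> z) * (deriv \<alpha> z * exp (\<alpha> z) - a))"
      using FG' by (auto simp: G_def f'')
    then have "deriv F z = exp (\<beta> z) * (deriv \<beta> z * (deriv \<alpha> z * exp (\<alpha> z) - a)
      + (deriv (deriv \<alpha>) z + deriv \<alpha> z ^ 2) * exp (\<alpha> z))"
      by (simp only:) (rule DERIV_imp_deriv, auto intro!: derivative_eq_intros Da simp: algebra_simps power2_eq_square)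
    ultimately show ?thesis using f' by simp
  qed
  define P where "P = (\<lambda>z. deriv \<beta> z * (deriv \<alpha> z - a) + (deriv (deriv \<alpha>) z + deriv \<alpha> z ^ 2))"
  have P0: "P z = 0" for z
  proof (rule vanishing_where_exp_is_one[OF al, where E = P])
    show "\<not> (\<exists>c. \<forall>z. \<alpha> z = c)"
    proof
      assume "\<exists>c. \<forall>z. \<alpha> z = c"
      then show False using nc f' by metis
    qed
    show "P holomorphic_on UNIV" unfolding P_def by (intro holomorphic_intros hd al be)
    show "growth_within (\<lambda>x. x) P" unfolding P_def
      by (intro growth_within_add growth_within_mult growth_within_minus growth_within_power growth_within_const
          growth_within_deriv gs hd al be gal gbe)
    show "polynomial_fun P" if p: "polynomial_fun \<alpha>" unfolding P_def
      by (intro polynomial_fun_add polynomial_fun_mult polynomial_fun_minus polynomial_fun_power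
          polynomial_fun_const polynomial_fun_deriv p polbe[OF p])
    show "P z = 0" if "exp (\<alpha> z) = 1" for z using dF[of z] that by (simp add: P_def)
  qed
  have "(exp (\<alpha> z) - 1) * (2 * f z - a * deriv \<beta> z * exp (\<beta> z)) = 0" for z
  proof -
    have s: "deriv (deriv \<alpha>) z + deriv \<alpha> z ^ 2 = - deriv \<beta> z * (deriv \<alpha> z - a)"
      using P0[of z] by (simp add: P_def add_eq_0_iff)
    show ?thesis using dF[of z] unfolding s by (simp add: algebra_simps)
  qed
  moreover have "\<exists>z. exp (\<alpha> z) - 1 \<noteq> 0" using nc f' by metis
  ultimately have "2 * f z - a * deriv \<beta> z * exp (\<beta> z) = 0" for z
    by (intro entire_mult_eq_0[of "\<lambda>z. exp (\<alpha> z) - 1" "\<lambda>z. 2 * f z - a * deriv \<beta> z * exp (\<beta> z)"])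
       (auto intro!: holomorphic_intros hd al be f)
  then have fb2: "2 * f z = a * deriv \<beta> z * exp (\<beta> z)" for z by simp
  \<comment> \<open>halving \<open>a\<close> once keeps fractions out of the derivatives\<close>
  define c where "c = a / 2"
  have ac: "a = 2 * c" by (simp add: c_def)
  have fb: "f z = c * deriv \<beta> z * exp (\<beta> z)" for z using fb2[of z] by (simp add: ac)
  define Q where "Q = (\<lambda>z. deriv (deriv (deriv \<beta>)) z + 3 * deriv \<beta> z * deriv (deriv \<beta>) z + deriv \<beta> z ^ 3)"
  have f'b: "deriv f z = c * (deriv (deriv \<beta>) z + deriv \<beta> z ^ 2) * exp (\<beta> z)" for z
  proof -
    have "f = (\<lambda>z. c * deriv \<beta> z * exp (\<beta> z))" using fb by auto
    then show ?thesis by (simp only:) (rule DERIV_imp_deriv,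
        auto intro!: derivative_eq_intros Da simp: algebra_simps power2_eq_square)
  qed
  have f''b: "deriv (deriv f) z = c * Q z * exp (\<beta> z)" for z
  proof -
    have "deriv f = (\<lambda>z. c * (deriv (deriv \<beta>) z + deriv \<beta> z ^ 2) * exp (\<beta> z))" using f'b by auto
    then show ?thesis by (simp only:) (rule DERIV_imp_deriv,
        auto intro!: derivative_eq_intros Da simp: Q_def algebra_simps power2_eq_square power3_eq_cube)
  qed
  define E where "E = (\<lambda>z. c * deriv \<beta> z ^ 2 - Q z)"
  have id: "exp (\<beta> z) ^ 2 * E z = 2 - 2 * exp (\<beta> z)" for z
  proof -
    have "(c * deriv \<beta> z * exp (\<beta> z)) ^ 2 - a = exp (\<beta> z) * (c * Q z * exp (\<beta> z) - a)"
      using FG[of z] unfolding f''b fb[of z] .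
    then have "c * (exp (\<beta> z) ^ 2 * E z) = c * (2 - 2 * exp (\<beta> z))"
      unfolding ac by (simp add: E_def power2_eq_square algebra_simps)
    then show ?thesis using a by (simp add: ac)
  qed
  have E0: "E z = 0" for z
  proof (rule vanishing_where_exp_is_one[OF be, where E = E])
    show "\<not> (\<exists>c. \<forall>z. \<beta> z = c)"
    proof
      assume "\<exists>c. \<forall>z. \<beta> z = c"
      then obtain k where "\<beta> = (\<lambda>_. k)" by auto
      then have "f w = 0" for w by (simp add: fb)
      then show False using fnz by blast
    qed
    show "E holomorphic_on UNIV" unfolding E_def Q_def by (intro holomorphic_intros hd be)
    show "growth_within (\<lambda>x. x) E" unfolding E_def Q_def
      by (intro growth_within_add growth_within_mult growth_within_minus growth_within_power growth_within_const
          growth_within_deriv gs hd be gbe)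
    show "polynomial_fun E" if "polynomial_fun \<beta>" unfolding E_def Q_def
      by (intro polynomial_fun_add polynomial_fun_mult polynomial_fun_minus polynomial_fun_power
          polynomial_fun_const polynomial_fun_deriv that)
    show "E z = 0" if "exp (\<beta> z) = 1" for z using id[of z] that by simp
  qed
  then have "exp (\<beta> z) = 1" for z using id[of z] by simp
  then have one: "(\<lambda>z. exp (\<beta> z)) = (\<lambda>_. 1)" by auto
  have "deriv (\<lambda>z. exp (\<beta> z)) z = exp (\<beta> z) * deriv \<beta> z" for z
    by (rule DERIV_imp_deriv) (auto intro!: derivative_eq_intros Da)
  then have "deriv \<beta> z = 0" for z unfolding one by simp
  then have "f z = 0" for z by (simp add: fb)
  then show False using fnz by blast
qed

theorem theorem3p1:
  fixes f :: "complex \<Rightarrow> complex" and a b :: complex and n :: nat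
  assumes "transcendental_entire f"
    and "hyper_order f < \<infinity>"
    and "a \<noteq> 0" and "b \<noteq> 0"
    and "n > 0"
    and "share_CM (\<lambda>z. f z ^ n) ((deriv ^^ 2) f) a"
    and "share_CM (\<lambda>z. ((deriv ^^ 1) f z) ^ n) ((deriv ^^ 1) f) b"
  shows "n = 1"
proof (rule ccontr)
  assume "n \<noteq> 1"
  then have n: "n \<ge> 2" using \<open>n > 0\<close> by simp
  have f: "f holomorphic_on UNIV" and tr: "\<And>p. \<exists>z. f z \<noteq> poly p z"
    using assms(1) by (auto simp: transcendental_entire_def)
  have f': "deriv f holomorphic_on UNIV" and f'': "deriv (deriv f) holomorphic_on UNIV"
    using f by (auto intro!: holomorphic_deriv)
  have fnz: "\<exists>w. f w \<noteq> 0" using tr[of 0] by simp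
  have nc: "\<not> (\<exists>c. \<forall>z. deriv f z = c)"
  proof
    assume "\<exists>c. \<forall>z. deriv f z = c"
    then obtain c where c: "\<And>z. deriv f z = c" by blast
    have "((\<lambda>z. f z - c * z) has_field_derivative 0) (at z)" for z
      using holomorphic_derivI[OF f open_UNIV UNIV_I, of z] c
      by (auto intro!: derivative_eq_intros)
    then obtain k where "\<And>z. f z - c * z = k"
      using has_field_derivative_zero_constant[of UNIV "\<lambda>z. f z - c * z"] by auto
    then have "f z = poly [:k, c:] z" for z by (simp add: algebra_simps diff_eq_eq)
    then show False using tr[of "[:k, c:]"] by blast
  qed
  have "deriv f z ^ n = b \<longleftrightarrow> deriv f z = b" for z
    using assms(7) by (simp add: share_CM_def)
  moreover have ncf: "deriv f \<noteq> (\<lambda>_. c)" for c using nc by auto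
  ultimately have n2: "n = 2" and omit: "\<And>z. deriv f z \<noteq> -1"
    using shared_power_omits_minus_one[OF f' ncf n \<open>b \<noteq> 0\<close>] by blast+
  have "deriv f z + 1 \<noteq> 0" for z using omit[of z] eq_neg_iff_add_eq_0[of "deriv f z" 1] by simp
  then obtain \<alpha> where al: "\<alpha> holomorphic_on UNIV" "\<And>z. exp (\<alpha> z) = deriv f z + 1"
    using holomorphic_logarithm_exists[of UNIV "\<lambda>z. deriv f z + 1" 0] holomorphic_on_add[OF f' holomorphic_on_const]
    by auto
  have sh: "\<And>z. f z ^ 2 - a = 0 \<longleftrightarrow> deriv (deriv f) z - a = 0"
    "\<And>z. f z ^ 2 - a = 0 \<Longrightarrow> zorder (\<lambda>w. f w ^ 2 - a) z = zorder (\<lambda>w. deriv (deriv f) w - a) z"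
    using assms(6) by (auto simp: share_CM_def n2 numeral_2_eq_2)
  have Gnz: "\<exists>w. deriv (deriv f) w - a \<noteq> 0"
  proof (rule ccontr)
    assume "\<not> ?thesis"
    then have "f z ^ 2 = a" for z using sh(1)[of z] by simp
    then show False using square_not_constant[OF f nc] by blast
  qed
  then have Fnz: "\<exists>w. f w ^ 2 - a \<noteq> 0" using sh(1) by blast
  obtain \<beta> where "\<beta> holomorphic_on UNIV" "\<And>z. f z ^ 2 - a = exp (\<beta> z) * (deriv (deriv f) z - a)"
    by (rule entire_same_zeros_quotient[OF _ Fnz _ Gnz sh]) (auto intro!: holomorphic_intros f f'')
  then show False
    using no_entire_sharing_square_and_second_derivative[OF f
        growth_within_exp_if_finite_hyper_order[OF f fnz assms(2)] \<open>a \<noteq> 0\<close> al(1) _ nc] al(2)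
    by (metis add_diff_cancel_right')
qed

end
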